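(* Suppose that $0<\alpha<1$ and $0<p<\infty$, and let $f\in A^p_\alpha$ with $f\not\equiv0$. If $I$ is a nonconstant inner function dividing $f$, then $$\|f/I\|_{\alpha,p}<\|f\|_{\alpha,p}.$$
   Context: $\mathbb{D}$ is the open unit disc in $\mathbb{C}$. For $f$ analytic in $\mathbb{D}$, $0<p<\infty$ and $0<r<1$, set $M_p^p(r,f)=\int_0^{2\pi}|f(re^{i\theta})|^p\,\frac{d\theta}{2\pi}$; the function $r\mapsto M_p^p(r,f)$ is increasing and differentiable on $(0,1)$. For $0<\alpha,p<\infty$ define $$\|f\|_{\alpha,p}^p=|f(0)|^p+\int_0^1\left(\frac{d}{dr}M_p^p(r,f)\right)(1-r^2)^{\alpha-1}\,dr\in[0,\infty],$$ and let $A^p_\alpha$ be the class of all analytic functions $f$ in $\mathbb{D}$ with $\|f\|_{\alpha,p}<\infty$. For $\alpha=1$ this is the Hardy space $H^p=A^p_1$, and $A^p_\alpha\subset H^p$ for $0<\alpha<1$, so every $f\in A^p_\alpha$ with $f\not\equiv 0$ has an inner-outer factorization. An inner function $I$ (bounded analytic in $\mathbb{D}$ with unimodular radial boundary values almost everywhere) divides $f\in H^p$ if it divides the inner factor of $f$, equivalently if $f/I\in H^p$. *)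

theory Defs
  imports "HOL-Complex_Analysis.Complex_Analysis"
begin

text \<open>
  Analytic functions in the open unit disc \<open>ball 0 1\<close> are functions \<open>complex \<Rightarrow> complex\<close> that are
  holomorphic there; their values outside the disc are never used.
\<close>

definition mean_pow :: "real \<Rightarrow> (complex \<Rightarrow> complex) \<Rightarrow> real \<Rightarrow> real" where
  "mean_pow p f r =
     (LBINT \<theta>:{0..2 * pi}. cmod (f (complex_of_real r * cis \<theta>)) powr p) / (2 * pi)"

text \<open>
  The $p$-th power of the norm, with values in $[0,\infty]$.  For analytic \<open>f\<close> the mean is increasing
  and differentiable in \<open>r\<close>, so the integrand is nonnegative and \<open>ennreal\<close> truncates nothing.
\<close>

definition A_norm_pow :: "real \<Rightarrow> real \<Rightarrow> (complex \<Rightarrow> complex) \<Rightarrow> ennreal" where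
  "A_norm_pow \<alpha> p f =
     ennreal (cmod (f 0) powr p) +
     (\<integral>\<^sup>+ r \<in> {0<..<1}. ennreal (deriv (mean_pow p f) r * (1 - r\<^sup>2) powr (\<alpha> - 1)) \<partial>lborel)"

definition A_norm :: "real \<Rightarrow> real \<Rightarrow> (complex \<Rightarrow> complex) \<Rightarrow> ennreal" where
  "A_norm \<alpha> p f =
     (if A_norm_pow \<alpha> p f = \<infinity> then \<infinity> else ennreal (enn2real (A_norm_pow \<alpha> p f) powr (1 / p)))"

definition A_space :: "real \<Rightarrow> real \<Rightarrow> (complex \<Rightarrow> complex) set" where
  "A_space \<alpha> p = {f. f holomorphic_on ball 0 1 \<and> A_norm \<alpha> p f < \<infinity>}"

definition hardy_space :: "real \<Rightarrow> (complex \<Rightarrow> complex) set" where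
  "hardy_space p = A_space 1 p"

definition inner_function :: "(complex \<Rightarrow> complex) \<Rightarrow> bool" where
  "inner_function I \<longleftrightarrow>
     I holomorphic_on ball 0 1 \<and> bounded (I ` ball 0 1) \<and>
     (AE \<theta> in lborel. \<theta> \<in> {0..2 * pi} \<longrightarrow>
        (\<exists>\<zeta>. cmod \<zeta> = 1 \<and> ((\<lambda>r. I (complex_of_real r * cis \<theta>)) \<longlongrightarrow> \<zeta>) (at_left 1)))"

text \<open>
  The analytic function \<open>f / I\<close>.  The pointwise quotient is \<open>0\<close> at the zeros of \<open>I\<close>, so there (the
  origin may be one of them) it has to be extended by its limit.  If \<open>f / I\<close> has a pole in the disc,
  then \<open>analytic_quotient f I\<close> is not holomorphic on the disc.
\<close>

definition analytic_quotient ::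
    "(complex \<Rightarrow> complex) \<Rightarrow> (complex \<Rightarrow> complex) \<Rightarrow> complex \<Rightarrow> complex" where
  "analytic_quotient f I = remove_sings (\<lambda>z. f z / I z)"

definition inner_divides :: "real \<Rightarrow> (complex \<Rightarrow> complex) \<Rightarrow> (complex \<Rightarrow> complex) \<Rightarrow> bool" where
  "inner_divides p I f \<longleftrightarrow> inner_function I \<and> analytic_quotient f I \<in> hardy_space p"

end

theory Submission
  imports Defs
begin

text \<open>
  Write \<open>f = I * g\<close> and let \<open>M f r\<close> be the mean \<open>mean_pow p f r\<close>.  The weight
  \<open>w r = (1 - r\<^sup>2) powr (\<alpha> - 1)\<close> has \<open>w 0 = 1\<close> and a positive derivative on the open unit interval, because
  \<open>\<alpha> < 1\<close>.  Integration by parts turns the norm into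
  \[ \|f\|_{\alpha,p}^p = M_f(1) + \int_0^1 w'(s)\,(M_f(1) - M_f(s))\,ds, \]
  where \<open>M f 1\<close> denotes the limit of the means at the boundary (\<open>A_norm_pow_eq_mean_defect\<close>).  Dividing by
  the inner function \<open>I\<close> leaves \<open>M f 1\<close> unchanged, since \<open>\<bar>I\<bar> = 1\<close> on the boundary
  (\<open>mean_pow_inner_multiple_tendsto\<close>), and strictly increases \<open>M f s\<close> for almost every \<open>s < 1\<close>, since
  \<open>\<bar>I\<bar> < 1\<close> in the disc.  So the integral becomes strictly smaller.

  The formula for the norm needs the means to be increasing, continuous, and differentiable off a
  locally finite set of radii.  Monotonicity rests on \<open>holomorphic_square_majorant\<close>: on a disc whose
  boundary circle contains no zeros of \<open>f\<close>, dividing out a finite Blaschke product and taking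
  the power \<open>p / 2\<close> gives a holomorphic \<open>H\<close> with \<open>\<bar>f\<bar> powr p \<le> \<bar>H\<bar>\<^sup>2\<close>, with equality on the circle; the mean of
  \<open>\<bar>H\<bar>\<^sup>2\<close> is increasing by Parseval.

  The equality of the boundary means amounts to uniform integrability of \<open>\<bar>g\<bar> powr p\<close> on circles of
  radius \<open>R\<close> near 1.  No radial limits of \<open>g\<close> are needed: with the majorant \<open>H\<close> of \<open>g\<close> for the disc of radius
  \<open>R\<close>, convergence of the means of \<open>g\<close> makes the high order Taylor coefficients of \<open>H\<close> small
  uniformly in \<open>R\<close> (\<open>tail_circle_mean_bound\<close>).  A Taylor polynomial of fixed degree is bounded, and against
  it \<open>1 - \<bar>I\<bar> powr p\<close> tends to 0 in mean.
\<close>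

section \<open>Means over circles and the identity of Parseval\<close>

text \<open>
  The average of \<open>u\<close> over the circle of radius \<open>r\<close> about the origin.
\<close>

definition circle_mean :: "(complex \<Rightarrow> real) \<Rightarrow> real \<Rightarrow> real" where
  "circle_mean u r = (LBINT \<theta>:{0..2 * pi}. u (complex_of_real r * cis \<theta>)) / (2 * pi)"

lemma mean_pow_eq_circle_mean: "mean_pow p f r = circle_mean (\<lambda>z. cmod (f z) powr p) r"
  by (simp add: mean_pow_def circle_mean_def)

lemma continuous_on_circle_param:
  assumes "continuous_on (sphere 0 r) u" "0 \<le> r"
  shows "continuous_on A (\<lambda>\<theta>. u (complex_of_real r * cis \<theta>))"
  by (rule continuous_on_compose2[OF assms(1)])
     (use assms(2) in \<open>auto intro!: continuous_intros simp: norm_mult\<close>)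

lemma set_integrable_circle:
  fixes u :: "complex \<Rightarrow> real"
  assumes "continuous_on (sphere 0 r) u" "0 \<le> r"
  shows "set_integrable lborel {0..2*pi} (\<lambda>\<theta>. u (complex_of_real r * cis \<theta>))"
  by (rule borel_integrable_compact[unfolded set_integrable_def[symmetric]])
     (use assms continuous_on_circle_param in auto)

lemma circle_mean_eq_integral:
  assumes "continuous_on (sphere 0 r) u" "0 \<le> r"
  shows "circle_mean u r = integral {0..2*pi} (\<lambda>\<theta>. u (complex_of_real r * cis \<theta>)) / (2*pi)"
  unfolding circle_mean_def
  using set_borel_integral_eq_integral(2)[OF set_integrable_circle[OF assms]] by simp

lemma circle_mean_cong:
  assumes "\<And>z. z \<in> sphere 0 r \<Longrightarrow> u z = v z" "0 \<le> r"
  shows "circle_mean u r = circle_mean v r"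
  unfolding circle_mean_def using assms
  by (intro arg_cong2[where f="(/)"] set_lebesgue_integral_cong) (auto simp: norm_mult)

lemma circle_mean_mono:
  assumes "continuous_on (sphere 0 r) u" "continuous_on (sphere 0 r) v" "0 \<le> r"
    and "\<And>z. z \<in> sphere 0 r \<Longrightarrow> u z \<le> v z"
  shows "circle_mean u r \<le> circle_mean v r"
  unfolding circle_mean_def
  by (intro divide_right_mono set_integral_mono set_integrable_circle assms)
     (use assms(3) in \<open>auto simp: norm_mult\<close>)

lemma circle_mean_add:
  assumes "continuous_on (sphere 0 r) u" "continuous_on (sphere 0 r) v" "0 \<le> r"
  shows "circle_mean (\<lambda>z. u z + v z) r = circle_mean u r + circle_mean v r"
  unfolding circle_mean_def
  using set_integral_add(2)[OF set_integrable_circle set_integrable_circle, OF assms(1,3) assms(2,3)]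
  by (simp add: add_divide_distrib)

lemma circle_mean_diff:
  assumes "continuous_on (sphere 0 r) u" "continuous_on (sphere 0 r) v" "0 \<le> r"
  shows "circle_mean (\<lambda>z. u z - v z) r = circle_mean u r - circle_mean v r"
  unfolding circle_mean_def
  using set_integral_diff(2)[OF set_integrable_circle set_integrable_circle, OF assms(1,3) assms(2,3)]
  by (simp add: diff_divide_distrib)

lemma circle_mean_cmult: "circle_mean (\<lambda>z. c * u z) r = c * circle_mean u r"
  unfolding circle_mean_def by simp

lemma circle_mean_const: "circle_mean (\<lambda>z. c) r = c"
proof -
  have "(LBINT \<theta>:{0..2*pi}. c) = c * (2 * pi)"
    by (subst set_borel_integral_eq_integral(2)) (auto simp: set_integrable_def)
  then show ?thesis by (simp add: circle_mean_def)
qed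

lemma circle_mean_nonneg:
  assumes "continuous_on (sphere 0 r) u" "0 \<le> r" "\<And>z. z \<in> sphere 0 r \<Longrightarrow> 0 \<le> u z"
  shows "0 \<le> circle_mean u r"
  using circle_mean_mono[of r "\<lambda>_. 0" u] assms by (simp add: circle_mean_const)

lemma circle_mean_sum:
  assumes "finite A" "\<And>i. i \<in> A \<Longrightarrow> continuous_on (sphere 0 r) (u i)" "0 \<le> r"
  shows "circle_mean (\<lambda>z. \<Sum>i\<in>A. u i z) r = (\<Sum>i\<in>A. circle_mean (u i) r)"
  using assms
  by (induction A rule: finite_induct) (simp_all add: circle_mean_const circle_mean_add continuous_on_sum)

text \<open>
  Orthogonality of distinct monomials on a circle.
\<close>

lemma circle_mean_Re_monomials:
  assumes "n \<noteq> m" "0 \<le> r"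
  shows "circle_mean (\<lambda>z. Re (c * z ^ n * cnj (z ^ m))) r = 0"
proof -
  \<comment> \<open>On the circle the product is a multiple of \<open>cis (k \<theta>)\<close> with an integer \<open>k \<noteq> 0\<close>, which has a periodic primitive.\<close>
  define k where "k = real n - real m"
  have k: "k \<noteq> 0" using assms by (simp add: k_def)
  have eq: "c * (complex_of_real r * cis \<theta>) ^ n * cnj ((complex_of_real r * cis \<theta>) ^ m)
      = c * of_real (r ^ (n + m)) * cis (k * \<theta>)" for \<theta>
  proof -
    have "cis (real n * \<theta>) * cis (- (real m * \<theta>)) = cis (k * \<theta>)"
      by (simp add: cis_mult k_def algebra_simps)
    then show ?thesis
      by (simp add: power_mult_distrib power_add Complex.DeMoivre cis_cnj algebra_simps)
  qed
  define d where "d = c * of_real (r ^ (n + m))"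
  have "((\<lambda>\<theta>. Re (d * cis (k * \<theta>))) has_integral
        (Im (d * cis (k * (2*pi))) / k - Im (d * cis (k * 0)) / k)) {0..2*pi}"
  proof (rule fundamental_theorem_of_calculus)
    fix x :: real assume "x \<in> {0..2*pi}"
    have "((\<lambda>x. Im (d * cis (k * x)) / k) has_real_derivative Re (d * cis (k * x))) (at x within {0..2*pi})"
      using k by (auto intro!: derivative_eq_intros simp: field_simps)
    then show "((\<lambda>x. Im (d * cis (k * x)) / k) has_vector_derivative Re (d * cis (k * x))) (at x within {0..2*pi})"
      by (simp add: has_real_derivative_iff_has_vector_derivative)
  qed simp
  moreover have "cis (k * (2*pi)) = 1"
  proof -
    have "k * (2*pi) = 2 * pi * of_int (int n - int m)" by (simp add: k_def)
    then show ?thesis using cis_multiple_2pi[of "of_int (int n - int m)"] by (metis Ints_of_int)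
  qed
  ultimately have "integral {0..2*pi} (\<lambda>\<theta>. Re (d * cis (k * \<theta>))) = 0"
    by (simp add: integral_unique)
  then show ?thesis
    by (subst circle_mean_eq_integral[OF _ assms(2)], intro continuous_intros, unfold eq d_def) simp
qed

lemma parseval_polynomial:
  assumes "0 \<le> r"
  shows "circle_mean (\<lambda>z. (cmod (\<Sum>n<N. a n * z ^ n))\<^sup>2) r = (\<Sum>n<N. (cmod (a n))\<^sup>2 * r ^ (2 * n))"
proof (induction N)
  case 0
  then show ?case by (simp add: circle_mean_const)
next
  case (Suc N)
  let ?P = "\<lambda>z. \<Sum>n<N. a n * z ^ n"
  have eq: "(cmod (\<Sum>n<Suc N. a n * z ^ n))\<^sup>2 =
     (cmod (?P z))\<^sup>2 + ((cmod (a N))\<^sup>2 * r ^ (2 * N) + 2 * (\<Sum>n<N. Re (a n * cnj (a N) * z ^ n * cnj (z ^ N))))"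
    if "z \<in> sphere 0 r" for z
  proof -
    have A: "(\<Sum>n<N. Re (a n * cnj (a N) * z ^ n * cnj (z ^ N))) = Re (?P z * cnj (a N * z ^ N))"
      unfolding Re_sum[symmetric] sum_distrib_right by (simp only: complex_cnj_mult mult_ac)
    have B: "(cmod (x + y))\<^sup>2 = (cmod x)\<^sup>2 + ((cmod y)\<^sup>2 + 2 * Re (x * cnj y))" for x y
      unfolding cmod_power2 by (simp add: power2_eq_square algebra_simps)
    have C: "(cmod (a N * z ^ N))\<^sup>2 = (cmod (a N))\<^sup>2 * r ^ (2 * N)"
      using that by (simp add: norm_mult norm_power power_mult_distrib power_mult[symmetric] mult.commute[of N 2])
    show ?thesis
      unfolding A C[symmetric] sum.lessThan_Suc by (rule B)
  qed
  let ?Q = "\<lambda>z. \<Sum>n<N. Re (a n * cnj (a N) * z ^ n * cnj (z ^ N))"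
  have "circle_mean ?Q r = (\<Sum>n<N. circle_mean (\<lambda>z. Re (a n * cnj (a N) * z ^ n * cnj (z ^ N))) r)"
    by (rule circle_mean_sum) (intro continuous_intros assms finite_lessThan)+
  also have "\<dots> = 0"
    by (rule sum.neutral, intro ballI circle_mean_Re_monomials) (use assms in auto)
  finally have Q: "circle_mean ?Q r = 0" .
  have "circle_mean (\<lambda>z. (cmod (\<Sum>n<Suc N. a n * z ^ n))\<^sup>2) r =
      circle_mean (\<lambda>z. (cmod (?P z))\<^sup>2 + ((cmod (a N))\<^sup>2 * r ^ (2 * N) + 2 * ?Q z)) r"
    by (rule circle_mean_cong[OF eq assms])
  also have "\<dots> = circle_mean (\<lambda>z. (cmod (?P z))\<^sup>2) r
      + circle_mean (\<lambda>z. (cmod (a N))\<^sup>2 * r ^ (2 * N) + 2 * ?Q z) r"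
    by (rule circle_mean_add) (intro continuous_intros assms)+
  also have "circle_mean (\<lambda>z. (cmod (a N))\<^sup>2 * r ^ (2 * N) + 2 * ?Q z) r
      = circle_mean (\<lambda>z. (cmod (a N))\<^sup>2 * r ^ (2 * N)) r + circle_mean (\<lambda>z. 2 * ?Q z) r"
    by (rule circle_mean_add) (intro continuous_intros assms)+
  finally show ?case
    unfolding circle_mean_cmult circle_mean_const Q Suc.IH by simp
qed

text \<open>
  Passage from polynomials to power series by dominated convergence: absolute convergence on the
  circle bounds all partial sums.
\<close>

lemma parseval_circle:
  assumes "0 \<le> r" and sm: "summable (\<lambda>n. cmod (a n) * r ^ n)"
    and f: "\<And>z. z \<in> sphere 0 r \<Longrightarrow> (\<lambda>n. a n * z ^ n) sums f z"
  shows "(\<lambda>n. (cmod (a n))\<^sup>2 * r ^ (2 * n)) sums circle_mean (\<lambda>z. (cmod (f z))\<^sup>2) r"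
proof -
  define B where "B = (\<Sum>n. cmod (a n) * r ^ n)"
  let ?S = "\<lambda>N z. (cmod (\<Sum>n<N. a n * z ^ n))\<^sup>2"
  have sph: "complex_of_real r * cis \<theta> \<in> sphere 0 r" for \<theta>
    using assms(1) by (simp add: norm_mult)
  have bd: "cmod (\<Sum>n<N. a n * z ^ n) \<le> B" if "z \<in> sphere 0 r" for z N
  proof -
    have "cmod (\<Sum>n<N. a n * z ^ n) \<le> (\<Sum>n<N. cmod (a n) * r ^ n)"
      by (rule sum_norm_le) (use that in \<open>simp add: norm_mult norm_power\<close>)
    also have "\<dots> \<le> B"
      unfolding B_def by (rule sum_le_suminf[OF sm]) (use assms(1) in auto)
    finally show ?thesis .
  qed
  have lim: "(\<lambda>N. ?S N z) \<longlonglongrightarrow> (cmod (f z))\<^sup>2" if "z \<in> sphere 0 r" for z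
    using f[OF that] unfolding sums_def by (intro tendsto_intros)
  have "(\<lambda>N. LBINT \<theta>:{0..2*pi}. ?S N (complex_of_real r * cis \<theta>))
        \<longlonglongrightarrow> (LBINT \<theta>:{0..2*pi}. (cmod (f (complex_of_real r * cis \<theta>)))\<^sup>2)"
    unfolding set_lebesgue_integral_def
  proof (rule integral_dominated_convergence[where w="\<lambda>\<theta>. indicator {0..2*pi} \<theta> *\<^sub>R B\<^sup>2"])
    have 1: "(\<lambda>\<theta>. indicator {0..2*pi} \<theta> *\<^sub>R ?S N (complex_of_real r * cis \<theta>)) \<in> borel_measurable lborel" for N
      by (rule borel_measurable_integrable, fold set_integrable_def, rule set_integrable_circle)
         (intro continuous_intros assms)+
    then show "(\<lambda>\<theta>. indicator {0..2*pi} \<theta> *\<^sub>R ?S N (complex_of_real r * cis \<theta>)) \<in> borel_measurable lborel" for N .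
    have 2: "(\<lambda>N. indicator {0..2*pi} \<theta> *\<^sub>R ?S N (complex_of_real r * cis \<theta>))
       \<longlonglongrightarrow> indicator {0..2*pi} \<theta> *\<^sub>R (cmod (f (complex_of_real r * cis \<theta>)))\<^sup>2" for \<theta>
      by (intro tendsto_intros lim sph)
    then show "AE \<theta> in lborel. (\<lambda>N. indicator {0..2*pi} \<theta> *\<^sub>R ?S N (complex_of_real r * cis \<theta>))
       \<longlonglongrightarrow> indicator {0..2*pi} \<theta> *\<^sub>R (cmod (f (complex_of_real r * cis \<theta>)))\<^sup>2" by auto
    show "(\<lambda>\<theta>. indicator {0..2*pi} \<theta> *\<^sub>R (cmod (f (complex_of_real r * cis \<theta>)))\<^sup>2) \<in> borel_measurable lborel"
      by (rule borel_measurable_LIMSEQ_real[OF 2 1])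
    show "integrable lborel (\<lambda>\<theta>. indicator {0..2*pi} \<theta> *\<^sub>R B\<^sup>2)" by simp
    show "AE \<theta> in lborel. norm (indicator {0..2*pi} \<theta> *\<^sub>R ?S N (complex_of_real r * cis \<theta>)) \<le> indicator {0..2*pi} \<theta> *\<^sub>R B\<^sup>2" for N
      using bd[OF sph] by (intro AE_I2) (auto simp: indicator_def intro!: power_mono)
  qed
  then have "(\<lambda>N. circle_mean (?S N) r) \<longlonglongrightarrow> circle_mean (\<lambda>z. (cmod (f z))\<^sup>2) r"
    unfolding circle_mean_def by (intro tendsto_divide) auto
  then show ?thesis
    unfolding sums_def parseval_polynomial[OF assms(1)] .
qed

section \<open>Replacing zeros by finite Blaschke products\<close>

text \<open>
  The Blaschke factor of the disc of radius \<open>R\<close> with zero \<open>\<xi>\<close> is the quotient of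
  \<open>w - \<xi>\<close> by \<open>(R\<^sup>2 - cnj \<xi> * w) / R\<close>.  By the following identity its modulus is at most 1 in the
  closed disc and equal to 1 on the circle.
\<close>

lemma blaschke_factor_identity:
  "(cmod (of_real (R\<^sup>2) - cnj \<xi> * w))\<^sup>2 - R\<^sup>2 * (cmod (w - \<xi>))\<^sup>2
     = (R\<^sup>2 - (cmod w)\<^sup>2) * (R\<^sup>2 - (cmod \<xi>)\<^sup>2)"
  unfolding cmod_power2 by (simp add: power2_eq_square algebra_simps)

lemma blaschke_factor_le:
  assumes "0 < R" "cmod w \<le> R" "cmod \<xi> \<le> R"
  shows "cmod (w - \<xi>) \<le> cmod ((of_real (R\<^sup>2) - cnj \<xi> * w) / of_real R)"
proof -
  have "0 \<le> (R\<^sup>2 - (cmod w)\<^sup>2) * (R\<^sup>2 - (cmod \<xi>)\<^sup>2)"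
    using assms by (intro mult_nonneg_nonneg) (auto intro: power_mono)
  then have "(R * cmod (w - \<xi>))\<^sup>2 \<le> (cmod (of_real (R\<^sup>2) - cnj \<xi> * w))\<^sup>2"
    using blaschke_factor_identity[of R \<xi> w] by (simp add: power_mult_distrib)
  then have "R * cmod (w - \<xi>) \<le> cmod (of_real (R\<^sup>2) - cnj \<xi> * w)"
    by (rule power2_le_imp_le) simp
  then show ?thesis using assms(1) by (simp add: norm_divide field_simps)
qed

lemma blaschke_factor_eq:
  assumes "0 < R" "cmod w = R"
  shows "cmod (w - \<xi>) = cmod ((of_real (R\<^sup>2) - cnj \<xi> * w) / of_real R)"
proof -
  have "(R * cmod (w - \<xi>))\<^sup>2 = (cmod (of_real (R\<^sup>2) - cnj \<xi> * w))\<^sup>2"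
    using blaschke_factor_identity[of R \<xi> w] assms by (simp add: power_mult_distrib)
  then have "R * cmod (w - \<xi>) = cmod (of_real (R\<^sup>2) - cnj \<xi> * w)"
    by (rule power2_eq_imp_eq) (use assms in auto)
  then show ?thesis using assms(1) by (simp add: norm_divide field_simps)
qed

text \<open>
  Division by the finite Blaschke product formed with the zeros of \<open>f\<close> in the disc of radius \<open>R\<close>:
  the zeros are removed one at a time, each zero together with its whole multiplicity \<open>n\<close>, by
  exchanging the factor \<open>(w - \<xi>) ^ n\<close> for the \<open>n\<close>-th power of the denominator of the Blaschke factor.
\<close>

lemma replace_zeros_by_blaschke:
  assumes "f holomorphic_on S" "open S" "connected S" "cball 0 R \<subseteq> S" "0 < R"
    and "\<And>z. z \<in> sphere 0 R \<Longrightarrow> f z \<noteq> 0"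
  obtains h where "h holomorphic_on S" "\<And>z. z \<in> cball 0 R \<Longrightarrow> h z \<noteq> 0"
    "\<And>z. z \<in> cball 0 R \<Longrightarrow> cmod (f z) \<le> cmod (h z)"
    "\<And>z. z \<in> sphere 0 R \<Longrightarrow> cmod (f z) = cmod (h z)"
proof -
  have "\<exists>h. h holomorphic_on S \<and> (\<forall>z\<in>cball 0 R. h z \<noteq> 0) \<and>
       (\<forall>z\<in>cball 0 R. cmod (f z) \<le> cmod (h z)) \<and> (\<forall>z\<in>sphere 0 R. cmod (f z) = cmod (h z))"
    using assms(1,6)
  proof (induction "card {z\<in>cball 0 R. f z = 0}" arbitrary: f rule: less_induct)
    case less
    show ?case
    proof (cases "\<exists>\<xi>\<in>cball 0 R. f \<xi> = 0")
      case False
      then show ?thesis using less.prems by (intro exI[of _ f]) auto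
    next
      case True
      then obtain \<xi> where \<xi>: "cmod \<xi> \<le> R" "f \<xi> = 0" by auto
      then have "\<xi> \<notin> sphere 0 R" using less.prems(2) by blast
      then have \<xi>R: "cmod \<xi> < R" using \<xi> by auto
      have \<xi>S: "\<xi> \<in> S" using \<xi> assms(4) by auto
      have "of_real R \<in> S" "f (of_real R) \<noteq> 0"
        using assms(4,5) less.prems(2)[of "of_real R"] by auto
      then have nc: "\<not> f constant_on S"
        using \<xi>S \<xi>(2) unfolding constant_on_def by metis
      obtain g r n where g: "0 < n" "0 < r" "ball \<xi> r \<subseteq> S" "g holomorphic_on ball \<xi> r"
         "\<And>w. w \<in> ball \<xi> r \<Longrightarrow> f w = (w - \<xi>) ^ n * g w" "\<And>w. w \<in> ball \<xi> r \<Longrightarrow> g w \<noteq> 0"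
        using holomorphic_factor_zero_nonconstant[OF less.prems(1) assms(2,3) \<xi>S \<xi>(2) nc] by metis
      define G where "G w = (if w = \<xi> then g \<xi> else f w / (w - \<xi>) ^ n)" for w
      have fG: "f w = (w - \<xi>) ^ n * G w" for w
        using \<xi>(2) g(1) by (auto simp: G_def)
      have "G holomorphic_on (S - {\<xi>}) \<union> ball \<xi> r"
      proof (rule holomorphic_on_Un)
        have "(\<lambda>w. f w / (w - \<xi>) ^ n) holomorphic_on (S - {\<xi>})"
          using less.prems(1) by (auto intro!: holomorphic_intros intro: holomorphic_on_subset)
        then show "G holomorphic_on (S - {\<xi>})"
          by (rule holomorphic_transform) (auto simp: G_def)
        show "G holomorphic_on ball \<xi> r"
          using g(4) by (rule holomorphic_transform) (use g(5) in \<open>auto simp: G_def\<close>)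
      qed (use assms(2) in auto)
      moreover have "(S - {\<xi>}) \<union> ball \<xi> r = S" using g(2,3) by auto
      ultimately have Gh: "G holomorphic_on S" by simp
      define B where "B w = (of_real (R\<^sup>2) - cnj \<xi> * w) / of_real R" for w
      have B0: "B w \<noteq> 0" if "cmod w \<le> R" for w
      proof
        assume "B w = 0"
        then have "cmod (of_real (R\<^sup>2)) = cmod (cnj \<xi> * w)"
          using assms(5) by (simp add: B_def)
        also have "\<dots> \<le> cmod \<xi> * R" using that by (simp add: norm_mult mult_left_mono)
        also have "\<dots> < R * R" using \<xi>R assms(5) by simp
        finally show False using assms(5) by (simp add: power2_eq_square norm_mult)
      qed
      let ?f = "\<lambda>w. B w ^ n * G w"
      have zero: "f w = 0 \<and> w \<noteq> \<xi>" if "cmod w \<le> R" "?f w = 0" for w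
        using that B0[OF that(1)] g(2) g(6)[of \<xi>] fG[of w] by (auto simp: G_def)
      have fin: "finite {z \<in> cball 0 R. f z = 0}"
        by (rule holomorphic_compact_finite_zeros[OF less.prems(1) assms(2,3) _ assms(4) nc]) auto
      have "card {z\<in>cball 0 R. ?f z = 0} < card {z\<in>cball 0 R. f z = 0}"
        by (rule psubset_card_mono[OF fin]) (use zero \<xi> in auto)
      moreover have "?f holomorphic_on S"
        unfolding B_def using Gh assms(5) by (intro holomorphic_intros) auto
      moreover have "?f z \<noteq> 0" if "z \<in> sphere 0 R" for z
        using zero[of z] less.prems(2)[OF that] that by fastforce
      ultimately obtain h where h: "h holomorphic_on S" "\<forall>z\<in>cball 0 R. h z \<noteq> 0"
        "\<forall>z\<in>cball 0 R. cmod (?f z) \<le> cmod (h z)" "\<forall>z\<in>sphere 0 R. cmod (?f z) = cmod (h z)"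
        using less.hyps[of ?f] by blast
      have "cmod (f z) \<le> cmod (h z)" if "z \<in> cball 0 R" for z
      proof -
        have "cmod (f z) \<le> cmod (?f z)"
          unfolding fG[of z] norm_mult norm_power B_def
          using blaschke_factor_le[of R z \<xi>] that assms(5) \<xi>
          by (intro mult_right_mono power_mono) auto
        then show ?thesis using h(3) that by fastforce
      qed
      moreover have "cmod (f z) = cmod (h z)" if "z \<in> sphere 0 R" for z
      proof -
        have "cmod (f z) = cmod (?f z)"
          unfolding fG[of z] norm_mult norm_power B_def
          using blaschke_factor_eq[of R z \<xi>] that assms(5) by simp
        then show ?thesis using h(4) that by fastforce
      qed
      ultimately show ?thesis using h by blast
    qed
  qed
  then show ?thesis using that by blast
qed

text \<open>
  The function \<open>h\<close> just constructed from \<open>f\<close> has no zeros near the closed disc, so \<open>h powr (p / 2)\<close>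
  has a holomorphic branch \<open>H\<close> there.
  This trades \<open>p\<close>-th powers of \<open>f\<close> for squares of \<open>H\<close>, to which Parseval applies.
\<close>

lemma holomorphic_square_majorant:
  assumes "f holomorphic_on ball 0 1" "0 < R" "R < 1" "\<And>z. z \<in> sphere 0 R \<Longrightarrow> f z \<noteq> 0" "0 < p"
  obtains H \<rho> where "R < \<rho>" "H holomorphic_on ball 0 \<rho>"
    "\<And>z. z \<in> cball 0 R \<Longrightarrow> cmod (f z) powr p \<le> (cmod (H z))\<^sup>2"
    "\<And>z. z \<in> sphere 0 R \<Longrightarrow> cmod (f z) powr p = (cmod (H z))\<^sup>2"
proof -
  have sub: "cball 0 R \<subseteq> ball 0 1" using assms(3) by auto
  obtain h where h: "h holomorphic_on ball 0 1" "\<And>z. z \<in> cball 0 R \<Longrightarrow> h z \<noteq> 0"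
    "\<And>z. z \<in> cball 0 R \<Longrightarrow> cmod (f z) \<le> cmod (h z)"
    "\<And>z. z \<in> sphere 0 R \<Longrightarrow> cmod (f z) = cmod (h z)"
    using replace_zeros_by_blaschke[OF assms(1) _ _ sub assms(2,4)] by auto
  have "\<exists>\<rho>>R. \<rho> \<le> 1 \<and> (\<forall>z\<in>ball 0 \<rho>. h z \<noteq> 0)"
  proof (cases "{z\<in>ball 0 1. h z = 0} = {}")
    case True
    then show ?thesis using assms(3) by (intro exI[of _ 1]) auto
  next
    case False
    have nc: "\<not> h constant_on ball 0 1"
      using False h(2)[of 0] assms(2) by (force simp: constant_on_def)
    define q where "q = (R + 1) / 2"
    have q: "R < q" "q < 1" using assms(3) by (auto simp: q_def)
    define Z where "Z = {z\<in>cball 0 q. h z = 0}"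
    have fin: "finite Z"
      unfolding Z_def
      by (rule holomorphic_compact_finite_zeros[OF h(1) _ _ _ _ nc]) (use q in auto)
    define \<rho> where "\<rho> = Min (insert q (cmod ` Z))"
    have "R < cmod z" if "z \<in> Z" for z
      using h(2)[of z] that unfolding Z_def by (simp, meson not_le)
    then have "R < \<rho>" using fin q by (simp add: \<rho>_def)
    moreover have "\<rho> \<le> q" "\<And>z. z \<in> Z \<Longrightarrow> \<rho> \<le> cmod z" using fin by (auto simp: \<rho>_def)
    ultimately show ?thesis using q unfolding Z_def by (intro exI[of _ \<rho>]) force
  qed
  then obtain \<rho> where \<rho>: "R < \<rho>" "\<rho> \<le> 1" "\<And>z. z \<in> ball 0 \<rho> \<Longrightarrow> h z \<noteq> 0" by blast
  have "h holomorphic_on ball 0 \<rho>" using h(1) by (rule holomorphic_on_subset) (use \<rho> in auto)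
  then obtain l where l: "l holomorphic_on ball 0 \<rho>" "\<And>z. z \<in> ball 0 \<rho> \<Longrightarrow> exp (l z) = h z"
    using holomorphic_logarithm_exists[of "ball 0 \<rho>" h 0] \<rho> assms(2) by auto
  define H where "H z = exp (of_real (p / 2) * l z)" for z
  have H: "(cmod (H z))\<^sup>2 = cmod (h z) powr p" if "z \<in> ball 0 \<rho>" for z
  proof -
    have "(cmod (H z))\<^sup>2 = exp (p * Re (l z))"
      by (simp add: H_def power2_eq_square exp_add[symmetric])
    also have "\<dots> = cmod (h z) powr p" 
      by (simp add: l(2)[OF that, symmetric] powr_def)
    finally show ?thesis .
  qed
  show thesis
  proof (rule that[OF \<rho>(1), of H])
    show "H holomorphic_on ball 0 \<rho>" unfolding H_def by (intro holomorphic_intros l)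
    show "cmod (f z) powr p \<le> (cmod (H z))\<^sup>2" if "z \<in> cball 0 R" for z
      using h(3)[OF that] H[of z] that \<rho> assms(5) by (auto intro!: powr_mono2)
    show "cmod (f z) powr p = (cmod (H z))\<^sup>2" if "z \<in> sphere 0 R" for z
      using h(4)[OF that] H[of z] that \<rho> by auto
  qed
qed

section \<open>Square means of holomorphic functions\<close>

text \<open>
  The Taylor coefficients of \<open>H\<close> at the origin.
\<close>

definition taylor_coeff :: "(complex \<Rightarrow> complex) \<Rightarrow> nat \<Rightarrow> complex" where
  "taylor_coeff H n = (deriv ^^ n) H 0 / fact n"

lemma taylor_coeff_sums:
  assumes "H holomorphic_on ball 0 \<rho>" "cmod z < \<rho>"
  shows "(\<lambda>n. taylor_coeff H n * z ^ n) sums H z"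
  using holomorphic_power_series[OF assms(1), of z] assms(2) by (simp add: taylor_coeff_def)

lemma taylor_coeff_summable:
  assumes "H holomorphic_on ball 0 \<rho>" "0 \<le> r" "r < \<rho>"
  shows "summable (\<lambda>n. cmod (taylor_coeff H n) * r ^ n)"
proof -
  define x where "x = complex_of_real ((r + \<rho>) / 2)"
  have x: "cmod x = (r + \<rho>) / 2" using assms by (simp add: x_def norm_divide flip: of_real_add)
  have "summable (\<lambda>n. taylor_coeff H n * x ^ n)"
    using taylor_coeff_sums[OF assms(1), of x] x assms by (auto simp: sums_iff)
  from powser_insidea[OF this, of "complex_of_real r"] show ?thesis
    using x assms by (simp add: norm_mult norm_power)
qed

lemma parseval_holomorphic:
  assumes "H holomorphic_on ball 0 \<rho>" "0 \<le> r" "r < \<rho>"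
  shows "(\<lambda>n. (cmod (taylor_coeff H n))\<^sup>2 * r ^ (2 * n)) sums circle_mean (\<lambda>z. (cmod (H z))\<^sup>2) r"
  using parseval_circle[OF assms(2) taylor_coeff_summable[OF assms]] taylor_coeff_sums[OF assms(1)] assms(3)
  by auto

lemma circle_mean_square_mono:
  assumes "H holomorphic_on ball 0 \<rho>" "0 \<le> r" "r \<le> R" "R < \<rho>"
  shows "circle_mean (\<lambda>z. (cmod (H z))\<^sup>2) r \<le> circle_mean (\<lambda>z. (cmod (H z))\<^sup>2) R"
proof (rule sums_le)
  show "(cmod (taylor_coeff H n))\<^sup>2 * r ^ (2 * n) \<le> (cmod (taylor_coeff H n))\<^sup>2 * R ^ (2 * n)" for n
    using assms by (intro mult_left_mono power_mono) auto
  show "(\<lambda>n. (cmod (taylor_coeff H n))\<^sup>2 * r ^ (2 * n)) sums circle_mean (\<lambda>z. (cmod (H z))\<^sup>2) r"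
    and "(\<lambda>n. (cmod (taylor_coeff H n))\<^sup>2 * R ^ (2 * n)) sums circle_mean (\<lambda>z. (cmod (H z))\<^sup>2) R"
    using assms by (auto intro!: parseval_holomorphic)
qed

section \<open>Growth and smoothness of integral means\<close>

text \<open>
  The radii of the circles in the unit disc that meet the zero set of \<open>f\<close>.  Away from them the
  mean of \<open>\<bar>f\<bar> powr p\<close> is smooth in the radius; at them, for small \<open>p\<close>, \<open>\<bar>f\<bar> powr p\<close> is not
  differentiable on the circle.
\<close>

definition zero_radii :: "(complex \<Rightarrow> complex) \<Rightarrow> real set" where
  "zero_radii f = cmod ` {z \<in> ball 0 1. f z = 0}"

lemma not_constant_if_zero:
  assumes "\<exists>z\<in>ball 0 1. f z \<noteq> 0" "z \<in> ball 0 1" "f z = 0"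
  shows "\<not> f constant_on (ball 0 1 :: complex set)"
  using assms unfolding constant_on_def by metis

lemma finite_zero_radii:
  assumes "f holomorphic_on ball 0 1" "\<exists>z\<in>ball 0 1. f z \<noteq> 0" "b < 1"
  shows "finite (zero_radii f \<inter> {..b})"
proof (cases "\<exists>z\<in>ball 0 1. f z = 0")
  case True
  then have "\<not> f constant_on ball 0 1" using not_constant_if_zero assms(2) by blast
  then have "finite {z\<in>cball 0 b. f z = 0}"
    by (intro holomorphic_compact_finite_zeros[OF assms(1)]) (use assms(3) in auto)
  then show ?thesis
    by (rule finite_surj[of _ _ cmod]) (auto simp: zero_radii_def)
next
  case False
  then have "zero_radii f = {}" unfolding zero_radii_def by blast
  then show ?thesis by simp
qed

lemma countable_zero_radii:
  assumes "f holomorphic_on ball 0 1" "\<exists>z\<in>ball 0 1. f z \<noteq> 0"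
  shows "countable (zero_radii f)"
proof -
  have "zero_radii f \<subseteq> (\<Union>n. zero_radii f \<inter> {..1 - 1 / real (Suc n)})"
  proof
    fix x assume x: "x \<in> zero_radii f"
    then have "0 < 1 - x" by (auto simp: zero_radii_def)
    then obtain n where "inverse (real (Suc n)) < 1 - x" using reals_Archimedean by blast
    then have "x \<in> zero_radii f \<inter> {..1 - 1 / real (Suc n)}"
      using x by (simp add: inverse_eq_divide)
    then show "x \<in> (\<Union>n. zero_radii f \<inter> {..1 - 1 / real (Suc n)})" by blast
  qed
  moreover have "countable (\<Union>n. zero_radii f \<inter> {..1 - 1 / real (Suc n)})"
    by (intro countable_UN countable_finite[OF finite_zero_radii[OF assms]]) auto
  ultimately show ?thesis by (rule countable_subset)
qed

lemma exists_radius_without_zeros: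
  assumes "f holomorphic_on ball 0 1" "\<exists>z\<in>ball 0 1. f z \<noteq> 0" "a < b"
  obtains R where "a < R" "R < b" "R \<notin> zero_radii f"
proof -
  have "uncountable ({a<..<b} - zero_radii f)"
    using assms countable_zero_radii[OF assms(1,2)]
    by (intro uncountable_minus_countable) (auto simp: uncountable_open_interval)
  then have "{a<..<b} - zero_radii f \<noteq> {}" by (metis countable_empty)
  then obtain R where "R \<in> {a<..<b} - zero_radii f" by blast
  then show ?thesis by (intro that[of R]) auto
qed

lemma nonzero_on_sphere:
  assumes "r \<notin> zero_radii f" "r < 1" "z \<in> sphere 0 r"
  shows "f z \<noteq> 0"
  using assms by (auto simp: zero_radii_def)

lemma continuous_on_sphere_powr:
  assumes "f holomorphic_on ball 0 1" "0 < p" "r < 1"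
  shows "continuous_on (sphere 0 r) (\<lambda>z. cmod (f z) powr p)"
proof -
  have "continuous_on (sphere 0 r) f"
    using assms(1) by (rule continuous_on_subset[OF holomorphic_on_imp_continuous_on]) (use assms(3) in auto)
  then show ?thesis using assms(2)
    by (intro continuous_on_powr' continuous_intros) auto
qed

lemma mean_pow_eq_integral:
  assumes "f holomorphic_on ball 0 1" "0 < p" "0 \<le> r" "r < 1"
  shows "mean_pow p f r = integral {0..2*pi} (\<lambda>\<theta>. cmod (f (complex_of_real r * cis \<theta>)) powr p) / (2*pi)"
  unfolding mean_pow_eq_circle_mean
  by (intro circle_mean_eq_integral continuous_on_sphere_powr assms)

lemma mean_pow_at_0: "mean_pow p f 0 = cmod (f 0) powr p"
  using circle_mean_const[of "cmod (f 0) powr p" 0] by (simp add: mean_pow_def circle_mean_def)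

lemma mean_pow_nonneg:
  assumes "f holomorphic_on ball 0 1" "0 < p" "0 \<le> r" "r < 1"
  shows "0 \<le> mean_pow p f r"
  unfolding mean_pow_eq_circle_mean
  by (intro circle_mean_nonneg continuous_on_sphere_powr assms) auto

lemma continuous_on_mean_pow:
  assumes "f holomorphic_on ball 0 1" "0 < p"
  shows "continuous_on {0..<1} (mean_pow p f)"
proof -
  have "continuous_on {0..<1} (\<lambda>r. integral (cbox 0 (2*pi)) (\<lambda>\<theta>. cmod (f (complex_of_real r * cis \<theta>)) powr p) / (2*pi))"
  proof (intro continuous_intros integral_continuous_on_param)
    have "continuous_on ({0..<1} \<times> cbox 0 (2*pi)) (\<lambda>x. f (complex_of_real (fst x) * cis (snd x)))"
      by (rule continuous_on_compose2[OF holomorphic_on_imp_continuous_on[OF assms(1)]])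
         (auto intro!: continuous_intros simp: norm_mult)
    then show "continuous_on ({0..<1} \<times> cbox 0 (2*pi)) (\<lambda>(r, \<theta>). cmod (f (complex_of_real r * cis \<theta>)) powr p)"
      using assms(2) by (auto intro!: continuous_on_powr' continuous_on_norm simp: case_prod_unfold)
  qed simp
  then show ?thesis
    by (rule continuous_on_cong[THEN iffD1, rotated -1]) (use mean_pow_eq_integral assms in auto)
qed

text \<open>
  For an outer radius whose circle contains no zero this is Parseval for the majorant \<open>H\<close>; the
  remaining radii follow by continuity.
\<close>

lemma mean_pow_mono:
  assumes "f holomorphic_on ball 0 1" "\<exists>z\<in>ball 0 1. f z \<noteq> 0" "0 < p" "0 \<le> r" "r \<le> R" "R < 1"
  shows "mean_pow p f r \<le> mean_pow p f R"
proof -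
  \<comment> \<open>The inequality for a zero-free outer circle.\<close>
  have good: "mean_pow p f r \<le> mean_pow p f R'" if R': "r \<le> R'" "0 < R'" "R' < 1" "R' \<notin> zero_radii f" for R'
  proof -
    obtain H \<rho> where H: "R' < \<rho>" "H holomorphic_on ball 0 \<rho>"
      "\<And>z. z \<in> cball 0 R' \<Longrightarrow> cmod (f z) powr p \<le> (cmod (H z))\<^sup>2"
      "\<And>z. z \<in> sphere 0 R' \<Longrightarrow> cmod (f z) powr p = (cmod (H z))\<^sup>2"
      using holomorphic_square_majorant[OF assms(1) R'(2,3) nonzero_on_sphere[OF R'(4,3)] assms(3)] by metis
    have "continuous_on (sphere 0 r) H"
      by (rule continuous_on_subset[OF holomorphic_on_imp_continuous_on[OF H(2)]]) (use R' H(1) in auto)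
    then have "mean_pow p f r \<le> circle_mean (\<lambda>z. (cmod (H z))\<^sup>2) r"
      unfolding mean_pow_eq_circle_mean using assms R' H(3)
      by (intro circle_mean_mono continuous_on_sphere_powr continuous_intros) auto
    also have "\<dots> \<le> circle_mean (\<lambda>z. (cmod (H z))\<^sup>2) R'"
      by (rule circle_mean_square_mono[OF H(2)]) (use assms R' H(1) in auto)
    also have "\<dots> = mean_pow p f R'"
      unfolding mean_pow_eq_circle_mean using R' H(4) by (intro circle_mean_cong) auto
    finally show ?thesis .
  qed
  show ?thesis
  proof (rule ccontr)
    assume "\<not> ?thesis"
    then have less: "mean_pow p f R < mean_pow p f r" by simp
    have R0: "0 \<le> R" using assms by simp
    have "continuous (at R within {0..<1}) (mean_pow p f)"
      using continuous_on_mean_pow[OF assms(1,3)] R0 assms(6) by (simp add: continuous_on_eq_continuous_within)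
    then have "eventually (\<lambda>x. mean_pow p f x < mean_pow p f r) (at R within {0..<1})"
      using less unfolding continuous_within by (rule order_tendstoD)
    then obtain d where d: "d > 0"
      "\<And>x. x \<in> {0..<1} \<Longrightarrow> x \<noteq> R \<Longrightarrow> dist x R < d \<Longrightarrow> mean_pow p f x < mean_pow p f r"
      unfolding eventually_at by blast
    obtain R' where R': "R < R'" "R' < min 1 (R + d)" "R' \<notin> zero_radii f"
      using exists_radius_without_zeros[OF assms(1,2), of R "min 1 (R+d)"] d(1) assms(6) by auto
    have "mean_pow p f R' < mean_pow p f r"
      by (rule d(2)) (use R' R0 in \<open>auto simp: dist_real_def\<close>)
    then show False using good[of R'] R' R0 assms(5) by auto
  qed
qed

text \<open>
  Differentiation under the integral sign, on an interval of radii free of zeros, where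
  \<open>\<bar>f\<bar> powr p\<close> is the smooth function \<open>(f \<bullet> f) powr (p / 2)\<close>.
\<close>

lemma mean_pow_differentiable:
  assumes f: "f holomorphic_on ball 0 1" "\<exists>z\<in>ball 0 1. f z \<noteq> 0" and p: "0 < p"
    and r: "0 < r" "r < 1" "r \<notin> zero_radii f"
  shows "(mean_pow p f has_real_derivative deriv (mean_pow p f) r) (at r)"
proof -
  define q where "q = (1 + r) / 2"
  have q: "r < q" "q < 1" using r by (auto simp: q_def)
  have "finite (zero_radii f \<inter> {..q})" by (rule finite_zero_radii[OF f q(2)])
  then obtain d where d: "d > 0" "\<And>x. x \<in> zero_radii f \<inter> {..q} \<Longrightarrow> x \<noteq> r \<Longrightarrow> d \<le> dist r x"
    using finite_set_avoid[of "zero_radii f \<inter> {..q}" r] by blast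
  define e where "e = Min {d, q - r, r}"
  have e: "e > 0" "e \<le> d" "e \<le> q - r" "e \<le> r" using d(1) q r by (auto simp: e_def)
  define U where "U = {r - e <..< r + e}"
  have U: "0 < x" "x < 1" "x \<notin> zero_radii f" if "x \<in> U" for x
  proof -
    show "0 < x" "x < 1" using that e q by (auto simp: U_def)
    show "x \<notin> zero_radii f"
      using that e d(2)[of x] r(3) by (cases "x = r") (auto simp: U_def dist_real_def)
  qed
  have rU: "r \<in> U" and oU: "open U" using e by (auto simp: U_def)
  let ?z = "\<lambda>x \<theta>. complex_of_real x * cis \<theta>"
  have zb: "?z x \<theta> \<in> ball 0 1" "f (?z x \<theta>) \<noteq> 0" if "x \<in> U" for x \<theta>
    using U[OF that] nonzero_on_sphere[of x f "?z x \<theta>"] by (auto simp: norm_mult)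
  define D where "D x \<theta> = p / 2 * (f (?z x \<theta>) \<bullet> f (?z x \<theta>)) powr (p / 2 - 1)
     * (2 * (f (?z x \<theta>) \<bullet> (cis \<theta> * deriv f (?z x \<theta>))))" for x \<theta>
  have powr_eq: "cmod w powr p = (w \<bullet> w) powr (p / 2)" for w
  proof (cases "w = 0")
    case False
    then have "(w \<bullet> w) powr (p / 2) = (cmod w powr 2) powr (p / 2)"
      by (simp add: dot_square_norm)
    also have "\<dots> = cmod w powr p" by (subst powr_powr) simp
    finally show ?thesis ..
  qed simp
  have der: "((\<lambda>x. cmod (f (?z x \<theta>)) powr p) has_real_derivative D x \<theta>) (at x within U)"
    if "x \<in> U" for x \<theta>
  proof -
    have "(f has_field_derivative deriv f (?z x \<theta>)) (at (?z x \<theta>))"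
      using f(1) zb[OF that] by (intro holomorphic_derivI[of f "ball 0 1"]) auto
    moreover have "((\<lambda>x. ?z x \<theta>) has_vector_derivative cis \<theta>) (at x within U)"
      by (auto intro!: derivative_eq_intros simp: has_vector_derivative_def scaleR_conv_of_real)
    ultimately have v: "((\<lambda>x. f (?z x \<theta>)) has_vector_derivative (cis \<theta> * deriv f (?z x \<theta>))) (at x within U)"
      using field_vector_diff_chain_within[of "\<lambda>x. ?z x \<theta>" "cis \<theta>" x U f "deriv f (?z x \<theta>)"]
      by (auto simp: o_def intro: has_field_derivative_at_within)
    have "((\<lambda>x. f (?z x \<theta>) \<bullet> f (?z x \<theta>)) has_real_derivative 2 * (f (?z x \<theta>) \<bullet> (cis \<theta> * deriv f (?z x \<theta>)))) (at x within U)"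
      using has_derivative_inner[OF v[unfolded has_vector_derivative_def] v[unfolded has_vector_derivative_def]]
      unfolding has_field_derivative_def
      by (rule has_derivative_eq_rhs) (auto simp: inner_commute)
    then have "((\<lambda>x. (f (?z x \<theta>) \<bullet> f (?z x \<theta>)) powr (p / 2)) has_real_derivative D x \<theta>) (at x within U)"
      unfolding D_def
      by (intro DERIV_chain2[where f="\<lambda>t. t powr (p / 2)"] has_real_derivative_powr)
         (use zb(2)[OF that, of \<theta>] in simp)
    then show ?thesis unfolding powr_eq .
  qed
  have cz: "continuous_on (U \<times> cbox 0 (2*pi)) (\<lambda>x. ?z (fst x) (snd x))"
    by (auto intro!: continuous_intros)
  have "continuous_on (U \<times> cbox 0 (2*pi)) (\<lambda>x. D (fst x) (snd x))"
  proof -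
    have im: "(\<lambda>x. ?z (fst x) (snd x)) ` (U \<times> cbox 0 (2*pi)) \<subseteq> ball 0 1"
      by (intro image_subsetI zb(1)) auto
    have c: "continuous_on (U \<times> cbox 0 (2*pi)) (\<lambda>x. f (?z (fst x) (snd x)))"
      by (rule continuous_on_compose2[OF holomorphic_on_imp_continuous_on[OF f(1)] cz im])
    have c': "continuous_on (U \<times> cbox 0 (2*pi)) (\<lambda>x. deriv f (?z (fst x) (snd x)))"
      by (rule continuous_on_compose2[OF holomorphic_on_imp_continuous_on[OF holomorphic_deriv[OF f(1) open_ball]] cz im])
    have nz: "f (?z (fst x) (snd x)) \<bullet> f (?z (fst x) (snd x)) \<noteq> 0" if "x \<in> U \<times> cbox 0 (2*pi)" for x
      using zb(2)[of "fst x" "snd x"] that unfolding inner_eq_zero_iff mem_Times_iff by blast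
    have "continuous_on (U \<times> cbox 0 (2*pi))
        (\<lambda>x. (f (?z (fst x) (snd x)) \<bullet> f (?z (fst x) (snd x))) powr (p / 2 - 1))"
      by (rule continuous_on_powr[OF continuous_on_inner[OF c c] continuous_on_const]) (use nz in blast)
    moreover have "continuous_on (U \<times> cbox 0 (2*pi))
        (\<lambda>x. f (?z (fst x) (snd x)) \<bullet> (cis (snd x) * deriv f (?z (fst x) (snd x))))"
      by (rule continuous_on_inner[OF c continuous_on_mult[OF continuous_on_cis[OF continuous_on_snd[OF continuous_on_id]] c']])
    ultimately show ?thesis
      unfolding D_def by (rule continuous_on_mult[OF continuous_on_mult[OF continuous_on_const] continuous_on_mult[OF continuous_on_const]])
  qed
  then have cD: "continuous_on (U \<times> cbox 0 (2*pi)) (\<lambda>(x, \<theta>). D x \<theta>)"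
    by (simp add: case_prod_unfold)
  have "((\<lambda>x. integral (cbox 0 (2*pi)) (\<lambda>\<theta>. cmod (f (?z x \<theta>)) powr p)) has_field_derivative
         integral (cbox 0 (2*pi)) (D r)) (at r within U)"
  proof (rule leibniz_rule_field_derivative[OF der _ cD])
    show "(\<lambda>\<theta>. cmod (f (?z x \<theta>)) powr p) integrable_on cbox 0 (2*pi)" if "x \<in> U" for x
      by (intro integrable_continuous continuous_on_circle_param[of x "\<lambda>z. cmod (f z) powr p"]
           continuous_on_sphere_powr) (use U[OF that] f p in auto)
    show "r \<in> U" "convex U" using e by (auto simp: U_def)
  qed auto
  then have "((\<lambda>x. integral {0..2*pi} (\<lambda>\<theta>. cmod (f (?z x \<theta>)) powr p) / (2*pi)) has_real_derivative
         integral {0..2*pi} (D r) / (2*pi)) (at r within U)"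
    by (auto intro!: derivative_eq_intros)
  then have "((\<lambda>x. integral {0..2*pi} (\<lambda>\<theta>. cmod (f (?z x \<theta>)) powr p) / (2*pi)) has_real_derivative
         integral {0..2*pi} (D r) / (2*pi)) (at r)"
    unfolding at_within_open[OF rU oU] .
  then have "(mean_pow p f has_real_derivative integral {0..2*pi} (D r) / (2*pi)) (at r)"
    by (rule has_field_derivative_transform_within_open[OF _ oU rU])
       (use U f(1) p in \<open>simp add: mean_pow_eq_integral less_imp_le\<close>)
  moreover from this have "deriv (mean_pow p f) r = integral {0..2*pi} (D r) / (2*pi)"
    by (rule DERIV_imp_deriv)
  ultimately show ?thesis by simp
qed

section \<open>The norm as an integral of the means\<close>

lemma mono_bounded_tendsto_at_left:
  fixes M :: "real \<Rightarrow> real"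
  assumes mono: "\<And>r s. 0 \<le> r \<Longrightarrow> r \<le> s \<Longrightarrow> s < 1 \<Longrightarrow> M r \<le> M s"
    and bd: "\<And>r. 0 \<le> r \<Longrightarrow> r < 1 \<Longrightarrow> M r \<le> C"
  obtains L where "(M \<longlongrightarrow> L) (at_left 1)"
proof
  let ?L = "Sup (M ` {0..<1})"
  have bdd: "bdd_above (M ` {0..<1})" using bd by (auto intro!: bdd_aboveI)
  have near: "eventually (\<lambda>r. r \<in> {s<..<1}) (at_left 1)" if "s < 1" for s :: real
    using that eventually_at_left_real by blast
  show "(M \<longlongrightarrow> ?L) (at_left 1)"
  proof (rule increasing_tendsto)
    show "eventually (\<lambda>r. M r \<le> ?L) (at_left 1)"
      using near[of 0] by (rule eventually_mono) (auto intro!: cSup_upper bdd)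
    fix x assume "x < ?L"
    then obtain s where s: "0 \<le> s" "s < 1" "x < M s"
      using less_cSup_iff[OF _ bdd, of x] by auto
    show "eventually (\<lambda>r. x < M r) (at_left 1)"
      using near[OF s(2)]
    proof (rule eventually_mono)
      show "x < M r" if "r \<in> {s<..<1}" for r using mono[OF s(1), of r] s(3) that by simp
    qed
  qed
qed

lemma mono_le_limit_at_left:
  fixes M :: "real \<Rightarrow> real"
  assumes mono: "\<And>r s. 0 \<le> r \<Longrightarrow> r \<le> s \<Longrightarrow> s < 1 \<Longrightarrow> M r \<le> M s"
    and lim: "(M \<longlongrightarrow> L) (at_left 1)" and s: "0 \<le> s" "s < 1"
  shows "M s \<le> L"
proof (rule tendsto_lowerbound[OF lim])
  have "eventually (\<lambda>r. r \<in> {s<..<1}) (at_left 1)" by (rule eventually_at_left_real[OF s(2)])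
  then show "eventually (\<lambda>r. M s \<le> M r) (at_left 1)"
    by (rule eventually_mono) (use mono[OF s(1)] in force)
qed simp

text \<open>
  The derivative of the mean, set to 0 outside the unit interval and at the countably many
  exceptional radii, so that it is nonnegative and Borel measurable everywhere.
\<close>

definition mean_pow_deriv :: "real \<Rightarrow> (complex \<Rightarrow> complex) \<Rightarrow> real \<Rightarrow> real" where
  "mean_pow_deriv p f r = indicator ({0<..<1} - zero_radii f) r * deriv (mean_pow p f) r"

context
  fixes f :: "complex \<Rightarrow> complex" and p :: real
  assumes f: "f holomorphic_on ball 0 1" "\<exists>z\<in>ball 0 1. f z \<noteq> 0" and p: "0 < p"
begin

lemma zero_radii_borel: "zero_radii f \<in> sets borel"
  by (rule sets.countable[OF _ countable_zero_radii[OF f]]) auto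

lemma mean_pow_deriv_nonneg: "0 \<le> mean_pow_deriv p f r"
proof (cases "r \<in> {0<..<1} - zero_radii f")
  case True
  then have d: "(mean_pow p f has_real_derivative deriv (mean_pow p f) r) (at r)"
    using mean_pow_differentiable[OF f p] by auto
  have "\<not> deriv (mean_pow p f) r < 0"
  proof
    assume "deriv (mean_pow p f) r < 0"
    from DERIV_neg_dec_right[OF d this] obtain e where e: "e > 0"
      "\<And>h. 0 < h \<Longrightarrow> h < e \<Longrightarrow> mean_pow p f r > mean_pow p f (r + h)" by blast
    define h where "h = min (e / 2) ((1 - r) / 2)"
    have "0 < h" "h < e" "r + h < 1" using e True by (auto simp: h_def min_def field_simps)
    then show False
      using e(2)[of h] mean_pow_mono[OF f p, of r "r + h"] True by auto
  qed
  then show ?thesis by (simp add: mean_pow_deriv_def)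
qed (auto simp: mean_pow_deriv_def)

lemma mean_pow_deriv_measurable [measurable]: "mean_pow_deriv p f \<in> borel_measurable borel"
proof -
  let ?A = "{0<..<1} - zero_radii f" and ?M = "mean_pow p f"
  \<comment> \<open>Difference quotients with an increment pointing towards 0, so that no radius exceeds 1.\<close>
  define D where "D n r = indicator ?A r *\<^sub>R ((?M r - ?M (r - r / real (n + 2))) / (r / real (n + 2)))" for n r
  have meas: "D n \<in> borel_measurable borel" for n
    unfolding D_def
  proof (rule borel_measurable_continuous_on_indicator)
    show "?A \<in> sets borel" using zero_radii_borel by auto
    show "continuous_on ?A (\<lambda>r. (?M r - ?M (r - r / real (n + 2))) / (r / real (n + 2)))"
    proof (intro continuous_intros continuous_on_compose2[OF continuous_on_mean_pow[OF f(1) p]])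
      have "r - r / real (n + 2) \<in> {0..<1}" if "0 < r" "r < 1" for r
      proof -
        have "r / real (n + 2) \<le> r / 1" "0 < r / real (n + 2)"
          using that by (intro divide_left_mono divide_pos_pos; simp)+
        then show ?thesis using that unfolding atLeastLessThan_iff by linarith
      qed
      then show "(\<lambda>r. r - r / real (n + 2)) ` ?A \<subseteq> {0..<1}" by auto
    qed auto
  qed
  have lim: "(\<lambda>n. D n r) \<longlonglongrightarrow> mean_pow_deriv p f r" for r
  proof (cases "r \<in> ?A")
    case True
    then have d: "(?M has_real_derivative deriv ?M r) (at r)"
      using mean_pow_differentiable[OF f p] by auto
    have lim0: "filterlim (\<lambda>n. - (r / real (n + 2))) (at 0) sequentially"
      unfolding filterlim_at
    proof
      have "(\<lambda>n. r / real (n + 2)) \<longlonglongrightarrow> 0"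
        by (rule real_tendsto_divide_at_top[OF tendsto_const]) 
           (rule filterlim_compose[OF filterlim_real_sequentially filterlim_add_const_nat_at_top])
      from tendsto_minus[OF this] show "(\<lambda>n. - (r / real (n + 2))) \<longlonglongrightarrow> 0" by simp
      show "eventually (\<lambda>n. - (r / real (n + 2)) \<in> UNIV \<and> - (r / real (n + 2)) \<noteq> 0) sequentially"
        using True by auto
    qed
    have "(\<lambda>n. (?M (r + - (r / real (n + 2))) - ?M r) / (- (r / real (n + 2)))) \<longlonglongrightarrow> deriv ?M r"
      by (rule filterlim_compose[OF d[unfolded DERIV_def] lim0])
    moreover have "D n r = (?M (r + - (r / real (n + 2))) - ?M r) / (- (r / real (n + 2)))" for n
    proof -
      have flip: "(x - y) / h = (y - x) / (- h)" for x y h :: real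
        using minus_divide_divide[of "x - y" h] unfolding minus_diff_eq by (rule sym)
      have "D n r = (?M r - ?M (r - r / real (n + 2))) / (r / real (n + 2))"
        using True by (simp only: D_def indicator_simps scaleR_one)
      also have "\<dots> = (?M (r + - (r / real (n + 2))) - ?M r) / (- (r / real (n + 2)))"
        unfolding add_uminus_conv_diff by (rule flip)
      finally show ?thesis .
    qed
    ultimately show ?thesis using True by (simp add: mean_pow_deriv_def)
  qed (simp add: D_def mean_pow_deriv_def)
  show ?thesis
    by (rule borel_measurable_LIMSEQ_real[OF lim meas])
qed

text \<open>
  The fundamental theorem of calculus tolerates finitely many exceptional points, and below any
  radius \<open>b < 1\<close> there are only finitely many exceptional radii.
\<close>

lemma nn_integral_mean_pow_deriv:
  assumes "0 \<le> a" "a \<le> b" "b < 1"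
  shows "(\<integral>\<^sup>+ r\<in>{a..b}. ennreal (mean_pow_deriv p f r) \<partial>lborel) = ennreal (mean_pow p f b - mean_pow p f a)"
proof -
  have "(mean_pow_deriv p f has_integral (mean_pow p f b - mean_pow p f a)) {a..b}"
  proof (rule fundamental_theorem_of_calculus_interior_strong)
    show "finite (zero_radii f \<inter> {..b})" by (rule finite_zero_radii[OF f assms(3)])
    show "continuous_on {a..b} (mean_pow p f)"
      by (rule continuous_on_subset[OF continuous_on_mean_pow[OF f(1) p]]) (use assms in auto)
    fix x assume x: "x \<in> {a<..<b} - zero_radii f \<inter> {..b}"
    then have "(mean_pow p f has_real_derivative deriv (mean_pow p f) x) (at x)"
      using assms by (intro mean_pow_differentiable[OF f p]) auto
    then show "(mean_pow p f has_vector_derivative mean_pow_deriv p f x) (at x)"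
      using x assms by (auto simp: mean_pow_deriv_def has_real_derivative_iff_has_vector_derivative)
  qed (use assms in auto)
  from nn_integral_has_integral_lebesgue'[OF mean_pow_deriv_nonneg this] show ?thesis .
qed

lemma nn_integral_mean_pow_deriv_tail:
  assumes L: "(mean_pow p f \<longlongrightarrow> L) (at_left 1)" and s: "0 \<le> s" "s < 1"
  shows "(\<integral>\<^sup>+ r\<in>{s<..<1}. ennreal (mean_pow_deriv p f r) \<partial>lborel) = ennreal (L - mean_pow p f s)"
proof -
  define b where "b n = 1 - (1 - s) / real (n + 1)" for n
  have b: "s \<le> b n" "b n < 1" for n
  proof -
    have "(1 - s) / real (n + 1) \<le> (1 - s) / 1" using s by (intro divide_left_mono) auto
    then show "s \<le> b n" "b n < 1" using s by (auto simp: b_def)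
  qed
  have binc: "b n \<le> b m" if "n \<le> m" for n m
    using that s unfolding b_def by (intro diff_mono divide_left_mono) auto
  have blim: "b \<longlonglongrightarrow> 1"
  proof -
    have "(\<lambda>n. (1 - s) / real (n + 1)) \<longlonglongrightarrow> 0"
      by (rule real_tendsto_divide_at_top[OF tendsto_const]) 
         (rule filterlim_compose[OF filterlim_real_sequentially filterlim_add_const_nat_at_top])
    from tendsto_diff[OF tendsto_const this, of 1] show ?thesis by (simp add: b_def[abs_def])
  qed
  let ?m = "\<lambda>r. ennreal (mean_pow_deriv p f r)"
  have "(\<lambda>n. \<integral>\<^sup>+ r. ?m r * indicator {s<..b n} r \<partial>lborel)
      \<longlonglongrightarrow> (\<integral>\<^sup>+ r. ?m r * indicator {s<..<1} r \<partial>lborel)"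
  proof (rule nn_integral_LIMSEQ)
    show "incseq (\<lambda>n r. ?m r * indicator {s<..b n} r)"
      using binc by (intro monoI le_funI mult_left_mono) (force simp: indicator_def)+
    show "(\<lambda>r. ?m r * indicator {s<..b n} r) \<in> borel_measurable lborel" for n by measurable
    show "(\<lambda>n. ?m r * indicator {s<..b n} r) \<longlonglongrightarrow> ?m r * indicator {s<..<1} r" for r
    proof (cases "r < 1")
      case True
      then have "eventually (\<lambda>n. r < b n) sequentially" using blim by (intro order_tendstoD)
      then have "eventually (\<lambda>n. ?m r * indicator {s<..b n} r = ?m r * indicator {s<..<1} r) sequentially"
        by (rule eventually_mono) (use True in \<open>auto simp: indicator_def\<close>)
      then show ?thesis by (rule tendsto_eventually)
    next
      case False
      then have "?m r * indicator {s<..b n} r = ?m r * indicator {s<..<1} r" for n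
        using b(2)[of n] by (auto simp: indicator_def)
      then show ?thesis by simp
    qed
  qed
  moreover have "(\<integral>\<^sup>+ r. ?m r * indicator {s<..b n} r \<partial>lborel) = ennreal (mean_pow p f (b n) - mean_pow p f s)" for n
  proof -
    have "(\<integral>\<^sup>+ r. ?m r * indicator {s<..b n} r \<partial>lborel) = (\<integral>\<^sup>+ r. ?m r * indicator {s..b n} r \<partial>lborel)"
      using AE_lborel_singleton[of s] by (intro nn_integral_cong_AE) (auto simp: indicator_def elim!: eventually_mono)
    then show ?thesis using nn_integral_mean_pow_deriv[OF s(1) b] by simp
  qed
  moreover have "(\<lambda>n. ennreal (mean_pow p f (b n) - mean_pow p f s)) \<longlonglongrightarrow> ennreal (L - mean_pow p f s)"
  proof (intro tendsto_ennrealI tendsto_intros)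
    have "filterlim b (at_left 1) sequentially"
      using blim by (simp add: filterlim_at b(2) less_imp_neq[OF b(2)])
    then show "(\<lambda>n. mean_pow p f (b n)) \<longlonglongrightarrow> L" by (rule filterlim_compose[OF L])
  qed
  ultimately show ?thesis by (simp add: LIMSEQ_unique)
qed

lemma A_norm_pow_eq_mean_pow_deriv:
  "A_norm_pow \<alpha> p f = ennreal (mean_pow p f 0)
     + (\<integral>\<^sup>+ r\<in>{0<..<1}. ennreal (mean_pow_deriv p f r * (1 - r\<^sup>2) powr (\<alpha> - 1)) \<partial>lborel)"
proof -
  have "AE r in lborel. r \<notin> zero_radii f"
    using countable_imp_null_set_lborel[OF countable_zero_radii[OF f]] by (rule AE_not_in)
  then show ?thesis
    unfolding A_norm_pow_def mean_pow_at_0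
    by (intro arg_cong2[where f="(+)"] refl nn_integral_cong_AE)
       (auto simp: mean_pow_deriv_def indicator_def elim!: eventually_mono)
qed

end

text \<open>
  Integration by parts in the form of Tonelli's theorem: \<open>w\<close> is replaced by 1 plus the integral of
  its derivative \<open>v\<close>, and the integrals over the triangle \<open>0 < s < r < 1\<close> are exchanged; \<open>G s\<close> is the integral
  of \<open>m\<close> beyond \<open>s\<close>.  No boundary term at 1 has to be controlled, and both sides may be infinite.
\<close>

lemma nn_integral_by_parts_Tonelli:
  fixes m w v G :: "real \<Rightarrow> real"
  assumes [measurable]: "m \<in> borel_measurable borel" "v \<in> borel_measurable borel"
    and m0: "\<And>r. 0 \<le> m r"
    and w: "\<And>r. 0 < r \<Longrightarrow> r < 1 \<Longrightarrow> ennreal (w r) = 1 + (\<integral>\<^sup>+ s\<in>{0<..<r}. ennreal (v s) \<partial>lborel)"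
    and G: "\<And>s. 0 \<le> s \<Longrightarrow> s < 1 \<Longrightarrow> (\<integral>\<^sup>+ r\<in>{s<..<1}. ennreal (m r) \<partial>lborel) = ennreal (G s)"
  shows "(\<integral>\<^sup>+ r\<in>{0<..<1}. ennreal (m r * w r) \<partial>lborel)
       = ennreal (G 0) + (\<integral>\<^sup>+ s\<in>{0<..<1}. ennreal (v s) * ennreal (G s) \<partial>lborel)"
proof -
  let ?k = "\<lambda>r s. ennreal (m r) * ennreal (v s) * indicator {0<..<1} r * indicator {0<..<r} s"
  have [measurable]: "(\<lambda>(r, s). ?k r s) \<in> borel_measurable (borel \<Otimes>\<^sub>M borel)"
    "(\<lambda>x. ?k (fst x) (snd x)) \<in> borel_measurable (borel \<Otimes>\<^sub>M borel)"
    unfolding indicator_def greaterThanLessThan_iff by measurable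
  have inner: "(\<integral>\<^sup>+ r. ?k r s \<partial>lborel) = ennreal (v s) * ennreal (G s) * indicator {0<..<1} s" for s
  proof (cases "s \<in> {0<..<1}")
    case True
    have "(\<integral>\<^sup>+ r. ?k r s \<partial>lborel) = (\<integral>\<^sup>+ r. ennreal (v s) * (ennreal (m r) * indicator {s<..<1} r) \<partial>lborel)"
      using True by (intro nn_integral_cong) (auto simp: indicator_def mult_ac)
    also have "\<dots> = ennreal (v s) * ennreal (G s)"
      using True G[of s] by (subst nn_integral_cmult) auto
    finally show ?thesis using True by simp
  next
    case False
    have "(\<integral>\<^sup>+ r. ?k r s \<partial>lborel) = (\<integral>\<^sup>+ (r::real). 0 \<partial>lborel)"
      by (rule nn_integral_cong) (use False in \<open>auto simp: indicator_def\<close>)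
    then show ?thesis using False by simp
  qed
  have "ennreal (m r * w r) * indicator {0<..<1} r =
      ennreal (m r) * indicator {0<..<1} r + (\<integral>\<^sup>+ s. ?k r s \<partial>lborel)" for r
  proof (cases "r \<in> {0<..<1}")
    case True
    then have "ennreal (m r * w r) = ennreal (m r) * (1 + (\<integral>\<^sup>+ s\<in>{0<..<r}. ennreal (v s) \<partial>lborel))"
      using w[of r] by (simp add: ennreal_mult'[OF m0])
    also have "\<dots> = ennreal (m r) + (\<integral>\<^sup>+ s. ennreal (m r) * (ennreal (v s) * indicator {0<..<r} s) \<partial>lborel)"
      by (subst nn_integral_cmult) (auto simp: distrib_left)
    finally show ?thesis using True by (simp add: mult.assoc)
  qed simp
  then have "(\<integral>\<^sup>+ r\<in>{0<..<1}. ennreal (m r * w r) \<partial>lborel) =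
     (\<integral>\<^sup>+ r. ennreal (m r) * indicator {0<..<1} r + (\<integral>\<^sup>+ s. ?k r s \<partial>lborel) \<partial>lborel)"
    by simp
  also have "\<dots> = (\<integral>\<^sup>+ r\<in>{0<..<1}. ennreal (m r) \<partial>lborel) + (\<integral>\<^sup>+ r. \<integral>\<^sup>+ s. ?k r s \<partial>lborel \<partial>lborel)"
    by (rule nn_integral_add) measurable
  also have "(\<integral>\<^sup>+ r. \<integral>\<^sup>+ s. ?k r s \<partial>lborel \<partial>lborel) = (\<integral>\<^sup>+ s. \<integral>\<^sup>+ r. ?k r s \<partial>lborel \<partial>lborel)"
    by (rule lborel_pair.Fubini') measurable
  also have "(\<integral>\<^sup>+ s. \<integral>\<^sup>+ r. ?k r s \<partial>lborel \<partial>lborel)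
      = (\<integral>\<^sup>+ s\<in>{0<..<1}. ennreal (v s) * ennreal (G s) \<partial>lborel)"
    unfolding inner ..
  finally show ?thesis using G[of 0] by simp
qed

lemma weight_eq_integral:
  fixes \<alpha> r :: real
  assumes "\<alpha> < 1" "0 < r" "r < 1"
  shows "ennreal ((1 - r\<^sup>2) powr (\<alpha> - 1)) =
     1 + (\<integral>\<^sup>+ s\<in>{0<..<r}. ennreal (2 * (1 - \<alpha>) * s * (1 - s\<^sup>2) powr (\<alpha> - 2)) \<partial>lborel)"
proof -
  let ?v = "\<lambda>s. 2 * (1 - \<alpha>) * s * (1 - s\<^sup>2) powr (\<alpha> - 2)" and ?w = "\<lambda>s. (1 - s\<^sup>2) powr (\<alpha> - 1)"
  have pos: "0 < 1 - s\<^sup>2" if "0 \<le> s" "s \<le> r" for s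
    using that assms power_less_one_iff[of s 2] by simp
  have "(?v has_integral (?w r - ?w 0)) {0..r}"
  proof (rule fundamental_theorem_of_calculus)
    fix s assume s: "s \<in> {0..r}"
    have "(?w has_real_derivative ?v s) (at s within {0..r})"
      using pos[of s] s by (auto intro!: derivative_eq_intros simp: algebra_simps)
    then show "(?w has_vector_derivative ?v s) (at s within {0..r})"
      by (simp add: has_real_derivative_iff_has_vector_derivative)
  qed (use assms in auto)
  then have "(\<integral>\<^sup>+ s\<in>{0..r}. ennreal (?v s) \<partial>lborel) = ennreal (?w r - 1)"
    using assms by (subst nn_integral_has_integral_lebesgue'[where I="?w r - 1"]) auto
  moreover have "(\<integral>\<^sup>+ s\<in>{0<..<r}. ennreal (?v s) \<partial>lborel) = (\<integral>\<^sup>+ s\<in>{0..r}. ennreal (?v s) \<partial>lborel)"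
    using AE_lborel_singleton[of 0] AE_lborel_singleton[of r]
    by (intro nn_integral_cong_AE) (auto simp: indicator_def)
  moreover have "1 \<le> ?w r"
    using powr_mono'[of "\<alpha> - 1" 0 "1 - r\<^sup>2"] pos[of r] assms by simp
  ultimately show ?thesis by (simp flip: ennreal_1 ennreal_plus)
qed

text \<open>
  The amount by which the mean at radius \<open>s\<close> falls short of the boundary value \<open>L\<close>, times the
  derivative of the weight \<open>(1 - s\<^sup>2) powr (\<alpha> - 1)\<close>; 0 outside the unit interval.
\<close>

definition weighted_defect :: "real \<Rightarrow> real \<Rightarrow> (complex \<Rightarrow> complex) \<Rightarrow> real \<Rightarrow> real \<Rightarrow> real" where
  "weighted_defect \<alpha> p f L s =
     indicator {0<..<1} s * (2 * (1 - \<alpha>) * s * (1 - s\<^sup>2) powr (\<alpha> - 2) * (L - mean_pow p f s))"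

text \<open>
  The norm in terms of the means themselves.  The value at the origin cancels against the lower
  limit of the integral of the derivative, leaving the boundary value \<open>L\<close>.
\<close>

lemma A_norm_pow_eq_mean_defect:
  assumes f: "f holomorphic_on ball 0 1" "\<exists>z\<in>ball 0 1. f z \<noteq> 0" and p: "0 < p" and \<alpha>: "\<alpha> < 1"
    and L: "(mean_pow p f \<longlongrightarrow> L) (at_left 1)"
  shows "A_norm_pow \<alpha> p f = ennreal L + (\<integral>\<^sup>+ s. ennreal (weighted_defect \<alpha> p f L s) \<partial>lborel)"
proof -
  let ?v = "\<lambda>s. 2 * (1 - \<alpha>) * s * (1 - s\<^sup>2) powr (\<alpha> - 2)" and ?M = "mean_pow p f"
  have le: "?M 0 \<le> L"
    by (rule mono_le_limit_at_left[OF mean_pow_mono[OF f p] L]) auto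
  have v: "?v \<in> borel_measurable borel" by measurable
  have "A_norm_pow \<alpha> p f = ennreal (?M 0)
     + (ennreal (L - ?M 0) + (\<integral>\<^sup>+ s\<in>{0<..<1}. ennreal (?v s) * ennreal (L - ?M s) \<partial>lborel))"
    unfolding A_norm_pow_eq_mean_pow_deriv[OF f p]
    by (intro arg_cong2[where f="(+)"] refl nn_integral_by_parts_Tonelli[OF mean_pow_deriv_measurable[OF f p] v mean_pow_deriv_nonneg[OF f p]
        weight_eq_integral[OF \<alpha>] nn_integral_mean_pow_deriv_tail[OF f p L]])
  also have "\<dots> = ennreal L + (\<integral>\<^sup>+ s\<in>{0<..<1}. ennreal (?v s) * ennreal (L - ?M s) \<partial>lborel)"
    using le mean_pow_nonneg[OF f(1) p, of 0] by (simp add: add.assoc[symmetric] flip: ennreal_plus)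
  also have "(\<integral>\<^sup>+ s\<in>{0<..<1}. ennreal (?v s) * ennreal (L - ?M s) \<partial>lborel)
      = (\<integral>\<^sup>+ s. ennreal (weighted_defect \<alpha> p f L s) \<partial>lborel)"
    by (rule nn_integral_cong) (use \<alpha> in \<open>auto simp: weighted_defect_def indicator_def ennreal_mult'\<close>)
  finally show ?thesis .
qed

lemma weighted_defect_measurable:
  assumes "f holomorphic_on ball 0 1" "0 < p"
  shows "weighted_defect \<alpha> p f L \<in> borel_measurable borel"
proof -
  have "continuous_on {0<..<1} (mean_pow p f)"
    by (rule continuous_on_subset[OF continuous_on_mean_pow[OF assms]]) auto
  then have "(\<lambda>s. indicator {0<..<1} s *\<^sub>R mean_pow p f s) \<in> borel_measurable borel"
    by (intro borel_measurable_continuous_on_indicator) auto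
  then have "(\<lambda>s. indicator {0<..<1} s * (2 * (1 - \<alpha>) * s * (1 - s\<^sup>2) powr (\<alpha> - 2) *
      (L - indicator {0<..<1} s *\<^sub>R mean_pow p f s))) \<in> borel_measurable borel"
    by measurable
  also have "(\<lambda>s. indicator {0<..<1} s * (2 * (1 - \<alpha>) * s * (1 - s\<^sup>2) powr (\<alpha> - 2) *
      (L - indicator {0<..<1} s *\<^sub>R mean_pow p f s))) = weighted_defect \<alpha> p f L"
    by (auto simp: weighted_defect_def fun_eq_iff indicator_def)
  finally show ?thesis .
qed

text \<open>
  For \<open>\<alpha> = 1\<close> the weight is 1, and the norm bounds the increase of the mean.
\<close>

lemma hardy_space_mean_pow_bounded:
  assumes f: "f \<in> hardy_space p" "\<exists>z\<in>ball 0 1. f z \<noteq> 0" and p: "0 < p"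
  shows "\<exists>C. \<forall>r\<in>{0..<1}. mean_pow p f r \<le> C"
proof -
  have h: "f holomorphic_on ball 0 1" and "A_norm_pow 1 p f \<noteq> \<infinity>"
    using f(1) by (auto simp: hardy_space_def A_space_def A_norm_def split: if_splits)
  then have fin: "A_norm_pow 1 p f < \<infinity>" by (simp add: less_top)
  have "ennreal (mean_pow p f r) \<le> A_norm_pow 1 p f" if r: "0 \<le> r" "r < 1" for r
  proof -
    have "ennreal (mean_pow p f r) = ennreal (mean_pow p f 0) + ennreal (mean_pow p f r - mean_pow p f 0)"
      using mean_pow_mono[OF h f(2) p, of 0 r] mean_pow_nonneg[OF h p, of 0] r
      by (simp flip: ennreal_plus)
    also have "ennreal (mean_pow p f r - mean_pow p f 0) = (\<integral>\<^sup>+ r\<in>{0..r}. ennreal (mean_pow_deriv p f r) \<partial>lborel)"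
      using nn_integral_mean_pow_deriv[OF h f(2) p, of 0 r] r by simp
    also have "\<dots> \<le> (\<integral>\<^sup>+ r\<in>{0<..<1}. ennreal (mean_pow_deriv p f r * (1 - r\<^sup>2) powr (1 - 1)) \<partial>lborel)"
      using AE_lborel_singleton[of 0] r
      by (intro nn_integral_mono_AE) (auto simp: indicator_def power_less_one_iff abs_square_less_1 power2_eq_1_iff elim!: eventually_mono)
    finally show ?thesis
      using A_norm_pow_eq_mean_pow_deriv[OF h f(2) p, of 1] by (simp add: add_left_mono)
  qed
  then have "mean_pow p f r \<le> enn2real (A_norm_pow 1 p f)" if "0 \<le> r" "r < 1" for r
    using that mean_pow_nonneg[OF h p that] fin enn2real_mono[of "ennreal (mean_pow p f r)" "A_norm_pow 1 p f"]
    by simp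
  then show ?thesis by (intro exI[of _ "enn2real (A_norm_pow 1 p f)"]) simp
qed

section \<open>Inner functions\<close>

lemma sum_le_sums:
  fixes f :: "nat \<Rightarrow> real"
  assumes "f sums s" "finite A" "\<And>n. 0 \<le> f n"
  shows "sum f A \<le> s"
  using sum_le_suminf[of f A] assms by (auto simp: sums_iff)

text \<open>
  Cauchy-Schwarz applied to the power series, followed by Parseval.
\<close>

lemma pointwise_bound_by_circle_mean:
  assumes H: "H holomorphic_on ball 0 \<rho>" and r: "0 < r" "r < \<rho>" and z: "cmod z < r"
  shows "(cmod (H z))\<^sup>2 \<le> circle_mean (\<lambda>z. (cmod (H z))\<^sup>2) r / (1 - (cmod z / r)\<^sup>2)"
proof (rule LIMSEQ_le_const2)
  let ?a = "taylor_coeff H" and ?q = "cmod z / r" and ?B = "circle_mean (\<lambda>z. (cmod (H z))\<^sup>2) r"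
  have q: "0 \<le> ?q" "?q < 1" using r z by auto
  then have q2: "?q\<^sup>2 < 1" by (simp add: power_less_one_iff)
  show "(\<lambda>N. (cmod (\<Sum>n<N. ?a n * z ^ n))\<^sup>2) \<longlonglongrightarrow> (cmod (H z))\<^sup>2"
    using taylor_coeff_sums[OF H, of z] z r unfolding sums_def by (intro tendsto_intros) auto
  have "(cmod (\<Sum>n<N. ?a n * z ^ n))\<^sup>2 \<le> ?B / (1 - ?q\<^sup>2)" for N
  proof -
    have "cmod (\<Sum>n<N. ?a n * z ^ n) \<le> (\<Sum>n<N. (cmod (?a n) * r ^ n) * ?q ^ n)"
      using r by (intro sum_norm_le) (simp add: norm_mult norm_power power_divide)
    then have "(cmod (\<Sum>n<N. ?a n * z ^ n))\<^sup>2 \<le> (\<Sum>n<N. (cmod (?a n) * r ^ n) * ?q ^ n)\<^sup>2"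
      by (rule power_mono) simp
    also have "\<dots> \<le> (\<Sum>n<N. (cmod (?a n) * r ^ n)\<^sup>2) * (\<Sum>n<N. (?q ^ n)\<^sup>2)"
      by (rule Cauchy_Schwarz_ineq_sum)
    also have "\<dots> \<le> ?B * (1 / (1 - ?q\<^sup>2))"
    proof (rule mult_mono)
      have P: "(\<lambda>n. (cmod (?a n) * r ^ n)\<^sup>2) sums ?B"
        using parseval_holomorphic[OF H, of r] r
        by (simp add: power_mult_distrib power_mult[symmetric] mult.commute)
      show "(\<Sum>n<N. (cmod (?a n) * r ^ n)\<^sup>2) \<le> ?B"
        by (rule sum_le_sums[OF P]) auto
      have G: "(\<lambda>n. (?q ^ n)\<^sup>2) sums (1 / (1 - ?q\<^sup>2))"
        using geometric_sums[of "?q\<^sup>2"] q2 by (simp add: power_mult[symmetric] mult.commute)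
      show "(\<Sum>n<N. (?q ^ n)\<^sup>2) \<le> 1 / (1 - ?q\<^sup>2)"
        by (rule sum_le_sums[OF G]) auto
      show "0 \<le> ?B" using sum_le_sums[OF P, of "{}"] by simp
    qed (auto intro: sum_nonneg)
    finally show ?thesis by simp
  qed
  then show "\<exists>N. \<forall>n\<ge>N. (cmod (\<Sum>n<n. ?a n * z ^ n))\<^sup>2 \<le> ?B / (1 - ?q\<^sup>2)" by blast
qed

lemma inner_function_circle_mean_tendsto:
  assumes I: "inner_function I" and \<phi>: "continuous_on {0..} \<phi>"
    and R: "filterlim R (at_left 1) sequentially" "\<And>k. 0 \<le> R k" "\<And>k. R k < 1"
  shows "(\<lambda>k. circle_mean (\<lambda>z. \<phi> (cmod (I z))) (R k)) \<longlonglongrightarrow> \<phi> 1"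
proof -
  have hol: "I holomorphic_on ball 0 1" and bd: "bounded (I ` ball 0 1)"
    and ae: "AE \<theta> in lborel. \<theta> \<in> {0..2 * pi} \<longrightarrow>
        (\<exists>\<zeta>. cmod \<zeta> = 1 \<and> ((\<lambda>r. I (complex_of_real r * cis \<theta>)) \<longlongrightarrow> \<zeta>) (at_left 1))"
    using I unfolding inner_function_def by auto
  let ?z = "\<lambda>k \<theta>. complex_of_real (R k) * cis \<theta>"
  have zb: "?z k \<theta> \<in> ball 0 1" for k \<theta> using R(2,3) by (simp add: norm_mult)
  obtain C where C: "\<And>z. z \<in> ball 0 1 \<Longrightarrow> cmod (I z) \<le> C"
    using bd unfolding bounded_iff by blast
  have "compact (\<phi> ` {0..C})"
    by (intro compact_continuous_image continuous_on_subset[OF \<phi>]) auto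
  then have "bounded (\<phi> ` {0..C})" by (rule compact_imp_bounded)
  then obtain B where "\<forall>y\<in>\<phi> ` {0..C}. norm y \<le> B" unfolding bounded_iff by blast
  then have B: "\<bar>\<phi> x\<bar> \<le> B" if "x \<in> {0..C}" for x using that by auto
  have cont: "continuous_on (sphere 0 (R k)) (\<lambda>z. \<phi> (cmod (I z)))" for k
    by (rule continuous_on_compose2[OF \<phi>],
        intro continuous_on_norm continuous_on_subset[OF holomorphic_on_imp_continuous_on[OF hol]])
       (use R(3)[of k] in auto)
  have "(\<lambda>k. LBINT \<theta>:{0..2*pi}. \<phi> (cmod (I (?z k \<theta>)))) \<longlonglongrightarrow> (LBINT \<theta>:{0..2*pi}. \<phi> 1)"
    unfolding set_lebesgue_integral_def
  proof (rule integral_dominated_convergence[where w="\<lambda>\<theta>. indicator {0..2*pi} \<theta> *\<^sub>R B"])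
    show "(\<lambda>\<theta>. indicator {0..2*pi} \<theta> *\<^sub>R \<phi> (cmod (I (?z k \<theta>)))) \<in> borel_measurable lborel" for k
      using set_integrable_circle[OF cont R(2)] unfolding set_integrable_def
      by (rule borel_measurable_integrable)
    show "AE \<theta> in lborel. (\<lambda>k. indicator {0..2*pi} \<theta> *\<^sub>R \<phi> (cmod (I (?z k \<theta>)))) \<longlonglongrightarrow> indicator {0..2*pi} \<theta> *\<^sub>R \<phi> 1"
      using ae
    proof (rule eventually_mono)
      fix \<theta> assume *: "\<theta> \<in> {0..2 * pi} \<longrightarrow>
        (\<exists>\<zeta>. cmod \<zeta> = 1 \<and> ((\<lambda>r. I (complex_of_real r * cis \<theta>)) \<longlongrightarrow> \<zeta>) (at_left 1))"
      show "(\<lambda>k. indicator {0..2*pi} \<theta> *\<^sub>R \<phi> (cmod (I (?z k \<theta>)))) \<longlonglongrightarrow> indicator {0..2*pi} \<theta> *\<^sub>R \<phi> 1"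
      proof (cases "\<theta> \<in> {0..2*pi}")
        case True
        with * obtain \<zeta> where \<zeta>: "cmod \<zeta> = 1" "((\<lambda>r. I (complex_of_real r * cis \<theta>)) \<longlongrightarrow> \<zeta>) (at_left 1)"
          by blast
        have "(\<lambda>k. cmod (I (?z k \<theta>))) \<longlonglongrightarrow> 1"
          using tendsto_norm[OF filterlim_compose[OF \<zeta>(2) R(1)]] \<zeta>(1) by simp
        then have "(\<lambda>k. \<phi> (cmod (I (?z k \<theta>)))) \<longlonglongrightarrow> \<phi> 1"
          by (rule continuous_on_tendsto_compose[OF \<phi>]) auto
        then show ?thesis by (intro tendsto_intros)
      qed simp
    qed
    show "integrable lborel (\<lambda>\<theta>. indicator {0..2*pi} \<theta> *\<^sub>R B)" by simp
    show "AE \<theta> in lborel. norm (indicator {0..2*pi} \<theta> *\<^sub>R \<phi> (cmod (I (?z k \<theta>)))) \<le> indicator {0..2*pi} \<theta> *\<^sub>R B" for k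
      using B C[OF zb] by (intro AE_I2) (auto simp: indicator_def)
  qed simp
  then have "(\<lambda>k. circle_mean (\<lambda>z. \<phi> (cmod (I z))) (R k)) \<longlonglongrightarrow> circle_mean (\<lambda>_. \<phi> 1) 0"
    unfolding circle_mean_def by (intro tendsto_divide) auto
  then show ?thesis by (simp add: circle_mean_const)
qed

lemma radii_to_boundary:
  assumes "g holomorphic_on ball 0 1" "\<exists>z\<in>ball 0 1. g z \<noteq> 0"
  obtains R where "filterlim R (at_left 1) sequentially" "\<And>k. 0 < R k" "\<And>k. R k < 1"
    "\<And>k. R k \<notin> zero_radii g"
proof -
  have "\<exists>x. 1 - 1 / real (k + 1) < x \<and> x < 1 \<and> x \<notin> zero_radii g" for k
    using exists_radius_without_zeros[OF assms, of "1 - 1 / real (k + 1)" 1] by auto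
  then obtain R where R: "\<And>k. 1 - 1 / real (k + 1) < R k" "\<And>k. R k < 1" "\<And>k. R k \<notin> zero_radii g"
    by metis
  have "(\<lambda>k. 1 / real (k + 1)) \<longlonglongrightarrow> 0"
    by (rule real_tendsto_divide_at_top[OF tendsto_const])
       (rule filterlim_compose[OF filterlim_real_sequentially filterlim_add_const_nat_at_top])
  from tendsto_diff[OF tendsto_const this, of 1] have "(\<lambda>k. 1 - 1 / real (k + 1)) \<longlonglongrightarrow> 1" by simp
  from tendsto_sandwich[OF _ _ this tendsto_const, of R] have "R \<longlonglongrightarrow> 1"
    using R by (simp add: less_imp_le)
  then have "filterlim R (at_left 1) sequentially"
    by (simp add: filterlim_at R(2) less_imp_neq[OF R(2)])
  moreover have "0 < R k" for k
  proof -
    have "0 \<le> 1 - 1 / real (k + 1)" by (simp add: field_simps)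
    then show ?thesis using R(1)[of k] by linarith
  qed
  ultimately show ?thesis using R that by blast
qed

text \<open>
  The pointwise bound for \<open>I ^ n\<close> loses only a factor independent of \<open>n\<close>, so letting \<open>n\<close> tend
  to infinity gives the sharp bound 1.
\<close>

lemma inner_function_norm_le_1:
  assumes I: "inner_function I" and z: "z \<in> ball 0 1"
  shows "cmod (I z) \<le> 1"
proof (rule ccontr)
  assume "\<not> ?thesis"
  then have gt: "1 < (cmod (I z))\<^sup>2" by (simp add: one_less_power)
  have hol: "I holomorphic_on ball 0 1" using I by (simp add: inner_function_def)
  have "\<exists>z\<in>ball 0 1. (1::complex) \<noteq> (0::complex)" by (rule bexI[of _ 0]) auto
  then obtain R :: "nat \<Rightarrow> real" where R: "filterlim R (at_left 1) sequentially" "\<And>k. 0 < R k" "\<And>k. R k < 1"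
    by (rule radii_to_boundary[OF holomorphic_on_const]) blast
  have R1: "R \<longlonglongrightarrow> 1" using R(1) by (simp add: filterlim_at)
  have "((cmod (I z))\<^sup>2) ^ n \<le> 1 / (1 - (cmod z)\<^sup>2)" for n
  proof (rule tendsto_lowerbound)
    have "continuous_on {0..} (\<lambda>x::real. (x ^ n)\<^sup>2)" by (intro continuous_intros)
    from inner_function_circle_mean_tendsto[OF I this R(1) less_imp_le[OF R(2)] R(3)]
    have "(\<lambda>k. circle_mean (\<lambda>z. (cmod (I z ^ n))\<^sup>2) (R k)) \<longlonglongrightarrow> 1" by (simp add: norm_power)
    moreover have "(cmod z)\<^sup>2 < 1" using z by (simp add: power_less_one_iff)
    ultimately show "(\<lambda>k. circle_mean (\<lambda>z. (cmod (I z ^ n))\<^sup>2) (R k) / (1 - (cmod z / R k)\<^sup>2))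
        \<longlonglongrightarrow> 1 / (1 - (cmod z)\<^sup>2)"
      using R1 by (auto intro!: tendsto_eq_intros)
    have "eventually (\<lambda>k. cmod z < R k) sequentially"
      using R1 z by (intro order_tendstoD) auto
    then show "eventually (\<lambda>k. ((cmod (I z))\<^sup>2) ^ n \<le>
        circle_mean (\<lambda>z. (cmod (I z ^ n))\<^sup>2) (R k) / (1 - (cmod z / R k)\<^sup>2)) sequentially"
    proof (rule eventually_mono)
      fix k assume "cmod z < R k"
      with pointwise_bound_by_circle_mean[of "\<lambda>z. I z ^ n" 1 "R k" z] R(2,3)[of k] hol
      show "((cmod (I z))\<^sup>2) ^ n \<le> circle_mean (\<lambda>z. (cmod (I z ^ n))\<^sup>2) (R k) / (1 - (cmod z / R k)\<^sup>2)"
        by (simp add: holomorphic_on_power norm_power power_mult[symmetric] mult.commute)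
    qed
  qed simp
  moreover obtain n where "1 / (1 - (cmod z)\<^sup>2) < ((cmod (I z))\<^sup>2) ^ n"
    using real_arch_pow[OF gt] by blast
  ultimately show False by (meson not_le)
qed

lemma inner_function_norm_less_1:
  assumes I: "inner_function I" "\<not> I constant_on ball 0 1" and z: "z \<in> ball 0 1"
  shows "cmod (I z) < 1"
proof (rule ccontr)
  assume "\<not> ?thesis"
  then have "cmod (I w) \<le> cmod (I z)" if "w \<in> ball 0 1" for w
    using inner_function_norm_le_1[OF I(1) that] by simp
  then have "I constant_on ball 0 1"
    using I(1) z by (intro maximum_modulus_principle[of I "ball 0 1" "ball 0 1" z])
      (auto simp: inner_function_def)
  then show False using I(2) by simp
qed

section \<open>Boundary means of multiples of inner functions\<close>

text \<open>
  If the mean of \<open>\<bar>H\<bar>\<^sup>2\<close> hardly grows between the radii \<open>r\<close> and \<open>R\<close>, then the Taylor coefficients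
  of high order carry little mass on the circle of radius \<open>R\<close>: for \<open>n \<ge> N\<close> at least half of
  \<open>R ^ (2 * n)\<close> is gained between \<open>r\<close> and \<open>R\<close>.  The bound is uniform in \<open>H\<close>.
\<close>

lemma tail_circle_mean_bound:
  assumes H: "H holomorphic_on ball 0 \<rho>" and r: "0 < r" "r < R" "R < \<rho>"
    and N: "(r / R) ^ (2 * N) \<le> 1 / 2"
  shows "circle_mean (\<lambda>z. (cmod (H z - (\<Sum>n<N. taylor_coeff H n * z ^ n)))\<^sup>2) R
     \<le> 2 * (circle_mean (\<lambda>z. (cmod (H z))\<^sup>2) R - circle_mean (\<lambda>z. (cmod (H z))\<^sup>2) r)"
proof (rule sums_le)
  let ?a = "taylor_coeff H"
  define b where "b n = (if n < N then 0 else ?a n)" for n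
  show "(\<lambda>n. (cmod (b n))\<^sup>2 * R ^ (2 * n)) sums circle_mean (\<lambda>z. (cmod (H z - (\<Sum>n<N. ?a n * z ^ n)))\<^sup>2) R"
  proof (rule parseval_circle)
    show "summable (\<lambda>n. cmod (b n) * R ^ n)"
      by (rule summable_comparison_test'[OF taylor_coeff_summable[OF H, of R], of 0]) (use r in \<open>auto simp: b_def\<close>)
    fix z :: complex assume "z \<in> sphere 0 R"
    then have "(\<lambda>n. ?a n * z ^ n) sums H z" using taylor_coeff_sums[OF H] r by auto
    then have "(\<lambda>n. ?a n * z ^ n - (if n \<in> {..<N} then ?a n * z ^ n else 0)) sums (H z - (\<Sum>n<N. ?a n * z ^ n))"
      by (intro sums_diff sums_If_finite_set) auto
    moreover have "?a n * z ^ n - (if n \<in> {..<N} then ?a n * z ^ n else 0) = b n * z ^ n" for n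
      by (simp add: b_def)
    ultimately show "(\<lambda>n. b n * z ^ n) sums (H z - (\<Sum>n<N. ?a n * z ^ n))" by simp
  qed (use r in auto)
  show "(\<lambda>n. 2 * ((cmod (?a n))\<^sup>2 * R ^ (2 * n) - (cmod (?a n))\<^sup>2 * r ^ (2 * n))) sums
     (2 * (circle_mean (\<lambda>z. (cmod (H z))\<^sup>2) R - circle_mean (\<lambda>z. (cmod (H z))\<^sup>2) r))"
    using r by (intro sums_mult sums_diff parseval_holomorphic[OF H]) auto
  show "(cmod (b n))\<^sup>2 * R ^ (2 * n) \<le> 2 * ((cmod (?a n))\<^sup>2 * R ^ (2 * n) - (cmod (?a n))\<^sup>2 * r ^ (2 * n))" for n
  proof (cases "n < N")
    case True
    have "(cmod (?a n))\<^sup>2 * r ^ (2 * n) \<le> (cmod (?a n))\<^sup>2 * R ^ (2 * n)"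
      using r by (intro mult_left_mono power_mono) auto
    then show ?thesis using True by (simp add: b_def)
  next
    case False
    have "(r / R) ^ (2 * n) \<le> (r / R) ^ (2 * N)" using False r by (intro power_decreasing) auto
    also note N
    finally have "2 * r ^ (2 * n) \<le> R ^ (2 * n)" using r by (simp add: power_divide field_simps)
    then have "R ^ (2 * n) \<le> 2 * (R ^ (2 * n) - r ^ (2 * n))" by simp
    then have "(cmod (?a n))\<^sup>2 * R ^ (2 * n) \<le> (cmod (?a n))\<^sup>2 * (2 * (R ^ (2 * n) - r ^ (2 * n)))"
      by (rule mult_left_mono) simp
    then show ?thesis using False by (simp add: b_def algebra_simps)
  qed
qed

text \<open>
  Splitting \<open>H\<close> into its Taylor polynomial of degree less than \<open>N\<close>, which is bounded on the circle in
  terms of the mean, and the tail estimated above.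
\<close>

lemma circle_mean_weighted_bound:
  assumes H: "H holomorphic_on ball 0 \<rho>" and r: "0 < r" "r < R" "R < \<rho>"
    and N: "(r / R) ^ (2 * N) \<le> 1 / 2"
    and u: "continuous_on (sphere 0 R) u" "\<And>z. z \<in> sphere 0 R \<Longrightarrow> 0 \<le> u z" "\<And>z. z \<in> sphere 0 R \<Longrightarrow> u z \<le> 1"
  shows "circle_mean (\<lambda>z. (cmod (H z))\<^sup>2 * u z) R
     \<le> 2 * (real N)\<^sup>2 * circle_mean (\<lambda>z. (cmod (H z))\<^sup>2) R * circle_mean u R
       + 4 * (circle_mean (\<lambda>z. (cmod (H z))\<^sup>2) R - circle_mean (\<lambda>z. (cmod (H z))\<^sup>2) r)"
proof -
  let ?a = "taylor_coeff H" and ?B = "circle_mean (\<lambda>z. (cmod (H z))\<^sup>2) R"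
  let ?P = "\<lambda>z. \<Sum>n<N. ?a n * z ^ n"
  have R: "0 \<le> R" using r by simp
  have P: "(\<lambda>n. (cmod (?a n))\<^sup>2 * R ^ (2 * n)) sums ?B" using r by (intro parseval_holomorphic[OF H]) auto
  have coeff: "cmod (?a n) * R ^ n \<le> sqrt ?B" for n
  proof (rule real_le_rsqrt)
    have "(cmod (?a n) * R ^ n)\<^sup>2 = (\<Sum>m\<in>{n}. (cmod (?a m))\<^sup>2 * R ^ (2 * m))"
      by (simp add: power_mult_distrib power_mult[symmetric] mult.commute)
    also have "\<dots> \<le> ?B" using R by (intro sum_le_sums[OF P]) auto
    finally show "(cmod (?a n) * R ^ n)\<^sup>2 \<le> ?B" .
  qed
  have B0: "0 \<le> ?B" using sum_le_sums[OF P, of "{}"] R by simp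
  have Pbd: "(cmod (?P z))\<^sup>2 \<le> (real N)\<^sup>2 * ?B" if "z \<in> sphere 0 R" for z
  proof -
    have "cmod (?P z) \<le> (\<Sum>n<N. sqrt ?B)"
      using coeff that by (intro sum_norm_le) (simp add: norm_mult norm_power)
    then have "(cmod (?P z))\<^sup>2 \<le> (real N * sqrt ?B)\<^sup>2" by (intro power_mono) auto
    then show ?thesis using B0 by (simp add: power_mult_distrib)
  qed
  have cH: "continuous_on (sphere 0 R) H"
    by (rule continuous_on_subset[OF holomorphic_on_imp_continuous_on[OF H]]) (use r in auto)
  have "circle_mean (\<lambda>z. (cmod (H z))\<^sup>2 * u z) R \<le>
      circle_mean (\<lambda>z. 2 * (real N)\<^sup>2 * ?B * u z + 2 * (cmod (H z - ?P z))\<^sup>2) R"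
  proof (rule circle_mean_mono)
    fix z :: complex assume z: "z \<in> sphere 0 R"
    have "cmod (H z) \<le> cmod (?P z) + cmod (H z - ?P z)" by (metis norm_triangle_sub)
    then have "(cmod (H z))\<^sup>2 \<le> (cmod (?P z) + cmod (H z - ?P z))\<^sup>2" by (rule power_mono) simp
    also have "\<dots> \<le> 2 * (cmod (?P z))\<^sup>2 + 2 * (cmod (H z - ?P z))\<^sup>2"
      using sum_squares_bound[of "cmod (?P z)" "cmod (H z - ?P z)"] by (simp add: power2_sum)
    also have "\<dots> \<le> 2 * ((real N)\<^sup>2 * ?B) + 2 * (cmod (H z - ?P z))\<^sup>2" using Pbd[OF z] by simp
    finally have "(cmod (H z))\<^sup>2 * u z \<le> (2 * ((real N)\<^sup>2 * ?B) + 2 * (cmod (H z - ?P z))\<^sup>2) * u z"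
      using u(2)[OF z] by (rule mult_right_mono)
    also have "\<dots> \<le> 2 * (real N)\<^sup>2 * ?B * u z + 2 * (cmod (H z - ?P z))\<^sup>2"
      using mult_left_mono[OF u(3)[OF z], of "2 * (cmod (H z - ?P z))\<^sup>2"] by (simp add: algebra_simps)
    finally show "(cmod (H z))\<^sup>2 * u z \<le> 2 * (real N)\<^sup>2 * ?B * u z + 2 * (cmod (H z - ?P z))\<^sup>2" .
  qed (intro continuous_intros cH u R)+
  also have "\<dots> = 2 * (real N)\<^sup>2 * ?B * circle_mean u R + 2 * circle_mean (\<lambda>z. (cmod (H z - ?P z))\<^sup>2) R"
    by (subst circle_mean_add) (intro continuous_intros cH u R | simp add: circle_mean_cmult)+
  also have "\<dots> \<le> 2 * (real N)\<^sup>2 * ?B * circle_mean u R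
      + 4 * (?B - circle_mean (\<lambda>z. (cmod (H z))\<^sup>2) r)"
    using tail_circle_mean_bound[OF H r N] by simp
  finally show ?thesis .
qed

lemma mean_pow_less:
  assumes f: "f holomorphic_on ball 0 1" and g: "g holomorphic_on ball 0 1" and p: "0 < p"
    and s: "0 < s" "s < 1" and less: "\<And>z. z \<in> sphere 0 s \<Longrightarrow> cmod (f z) < cmod (g z)"
  shows "mean_pow p f s < mean_pow p g s"
proof -
  let ?u = "\<lambda>z. cmod (g z) powr p - cmod (f z) powr p"
  have cont: "continuous_on (sphere 0 s) (\<lambda>z. cmod (g z) powr p)" "continuous_on (sphere 0 s) (\<lambda>z. cmod (f z) powr p)"
    using f g p s by (auto intro: continuous_on_sphere_powr)
  have cu: "continuous_on (sphere 0 s) ?u" by (intro continuous_intros cont)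
  have "complex_of_real s \<in> sphere 0 s" using s by simp
  then obtain x where x: "x \<in> sphere 0 s" "\<And>y. y \<in> sphere 0 s \<Longrightarrow> ?u x \<le> ?u y"
    using continuous_attains_inf[OF compact_sphere _ cu] by blast
  have "0 < ?u x" using less[OF x(1)] p by (simp add: powr_less_mono2)
  also have "\<dots> \<le> circle_mean ?u s"
    using circle_mean_mono[OF continuous_on_const cu _ x(2)] s by (simp add: circle_mean_const)
  also have "\<dots> = mean_pow p g s - mean_pow p f s"
    unfolding mean_pow_eq_circle_mean using s by (intro circle_mean_diff cont) auto
  finally show ?thesis by simp
qed

lemma mean_pow_mono_norm:
  assumes f: "f holomorphic_on ball 0 1" and g: "g holomorphic_on ball 0 1" and p: "0 < p"
    and s: "0 \<le> s" "s < 1" and le: "\<And>z. z \<in> ball 0 1 \<Longrightarrow> cmod (f z) \<le> cmod (g z)"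
  shows "mean_pow p f s \<le> mean_pow p g s"
  unfolding mean_pow_eq_circle_mean
  using f g p s le by (intro circle_mean_mono continuous_on_sphere_powr powr_mono2) auto

text \<open>
  Multiplication by an inner function does not change the boundary value of the mean.  This is
  where uniform integrability enters.  On a zero-free circle of radius \<open>R k\<close>, \<open>\<bar>g\<bar> powr p\<close> equals
  \<open>\<bar>H\<bar>\<^sup>2\<close> for a holomorphic \<open>H\<close> depending on the circle.  The mean of \<open>\<bar>H\<bar>\<^sup>2\<close> grows by less than
  \<open>e / 4\<close> between the fixed radius \<open>r0\<close> and \<open>R k\<close>, because the means of \<open>g\<close> converge, so one \<open>N\<close>
  serves for all \<open>k\<close>, and the mean of \<open>1 - \<bar>I\<bar> powr p\<close> tends to 0.
\<close>

lemma mean_pow_inner_multiple_tendsto: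
  assumes I: "inner_function I" and g: "g holomorphic_on ball 0 1" "\<exists>z\<in>ball 0 1. g z \<noteq> 0"
    and f: "f holomorphic_on ball 0 1" "\<exists>z\<in>ball 0 1. f z \<noteq> 0"
    and fg: "\<And>z. z \<in> ball 0 1 \<Longrightarrow> f z = I z * g z"
    and p: "0 < p" and L: "(mean_pow p g \<longlongrightarrow> L) (at_left 1)"
  shows "(mean_pow p f \<longlongrightarrow> L) (at_left 1)"
proof -
  let ?Mf = "mean_pow p f" and ?Mg = "mean_pow p g"
  have I1: "cmod (I z) \<le> 1" if "z \<in> ball 0 1" for z by (rule inner_function_norm_le_1[OF I that])
  have holI: "I holomorphic_on ball 0 1" using I by (simp add: inner_function_def)
  have gL: "?Mg r \<le> L" if "0 \<le> r" "r < 1" for r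
    by (rule mono_le_limit_at_left[OF mean_pow_mono[OF g p] L that])
  have fg_le: "?Mf r \<le> ?Mg r" if "0 \<le> r" "r < 1" for r
    by (rule mean_pow_mono_norm[OF f(1) g(1) p that])
       (use I1 in \<open>auto simp: fg norm_mult intro!: mult_left_le_one_le\<close>)
  obtain L' where L': "(?Mf \<longlongrightarrow> L') (at_left 1)"
    by (rule mono_bounded_tendsto_at_left[of ?Mf L]) (use mean_pow_mono[OF f p] fg_le gL in \<open>force+\<close>)
  obtain R where R: "filterlim R (at_left 1) sequentially" "\<And>k. 0 < R k" "\<And>k. R k < 1"
    "\<And>k. R k \<notin> zero_radii g"
    using radii_to_boundary[OF g] by blast
  have R1: "R \<longlonglongrightarrow> 1" using R(1) by (simp add: filterlim_at)
  have Mg: "(\<lambda>k. ?Mg (R k)) \<longlonglongrightarrow> L" and Mf: "(\<lambda>k. ?Mf (R k)) \<longlonglongrightarrow> L'"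
    using filterlim_compose[OF L R(1)] filterlim_compose[OF L' R(1)] by auto
  define d where "d k = 1 - circle_mean (\<lambda>z. cmod (I z) powr p) (R k)" for k
  have d: "d \<longlonglongrightarrow> 0"
  proof -
    have "continuous_on {0..} (\<lambda>x::real. x powr p)" using p by (intro continuous_on_powr' continuous_intros) auto
    from inner_function_circle_mean_tendsto[OF I this R(1) less_imp_le[OF R(2)] R(3)]
    have "(\<lambda>k. circle_mean (\<lambda>z. cmod (I z) powr p) (R k)) \<longlonglongrightarrow> 1" by simp
    from tendsto_diff[OF tendsto_const this, of 1] show ?thesis by (simp add: d_def[abs_def])
  qed
  have "L' \<le> L" by (rule LIMSEQ_le[OF Mf Mg]) (use fg_le R(2,3) in \<open>auto intro: less_imp_le\<close>)
  moreover have "L \<le> L'"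
  proof (rule field_le_epsilon)
    fix e :: real assume e: "0 < e"
    have "eventually (\<lambda>r. L - e / 4 < ?Mg r \<and> r \<in> {0<..<1}) (at_left 1)"
      using order_tendstoD(1)[OF L, of "L - e / 4"] e eventually_at_left_real[of 0 "1::real"]
      by (auto intro: eventually_conj)
    then obtain r0 where r0: "L - e / 4 < ?Mg r0" "0 < r0" "r0 < 1"
      using eventually_happens'[OF trivial_limit_at_left_real] by auto
    define r1 where "r1 = (1 + r0) / 2"
    have r1: "r0 < r1" "r1 < 1" using r0 by (auto simp: r1_def)
    have "((r0 / r1)\<^sup>2) < 1" using r0 r1 by (simp add: power_less_one_iff)
    then obtain N where "((r0 / r1)\<^sup>2) ^ N < 1 / 2" using real_arch_pow_inv[of "1/2" "(r0 / r1)\<^sup>2"] by auto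
    then have N: "(r0 / r1) ^ (2 * N) \<le> 1 / 2" by (simp add: power_mult)
    have est: "?Mg (R k) - ?Mf (R k) \<le> 2 * (real N)\<^sup>2 * L * d k + e" if k: "r1 < R k" for k
    proof -
      let ?R = "R k"
      obtain H \<rho> where H: "?R < \<rho>" "H holomorphic_on ball 0 \<rho>"
        "\<And>z. z \<in> cball 0 ?R \<Longrightarrow> cmod (g z) powr p \<le> (cmod (H z))\<^sup>2"
        "\<And>z. z \<in> sphere 0 ?R \<Longrightarrow> cmod (g z) powr p = (cmod (H z))\<^sup>2"
        by (rule holomorphic_square_majorant[OF g(1) R(2)[of k] R(3)[of k]
              nonzero_on_sphere[OF R(4)[of k] R(3)[of k]] p]) blast+
      let ?m = "circle_mean (\<lambda>z. (cmod (H z))\<^sup>2)"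
      let ?u = "\<lambda>z. 1 - cmod (I z) powr p"
      have sph: "sphere 0 ?R \<subseteq> ball 0 1" using R(3)[of k] by auto
      have cI: "continuous_on (sphere 0 ?R) (\<lambda>z. cmod (I z) powr p)"
        by (rule continuous_on_sphere_powr[OF holI p R(3)])
      have mR: "?m ?R = ?Mg ?R"
        unfolding mean_pow_eq_circle_mean using H(4) R(2)[of k] by (intro circle_mean_cong) auto
      have cH: "continuous_on (sphere 0 r0) H"
        by (rule continuous_on_subset[OF holomorphic_on_imp_continuous_on[OF H(2)]]) (use r0 r1 k H(1) in auto)
      have mr: "?Mg r0 \<le> ?m r0"
        unfolding mean_pow_eq_circle_mean
      proof (rule circle_mean_mono)
        show "continuous_on (sphere 0 r0) (\<lambda>z. (cmod (H z))\<^sup>2)" by (intro continuous_intros cH)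
        show "cmod (g z) powr p \<le> (cmod (H z))\<^sup>2" if "z \<in> sphere 0 r0" for z
          by (rule H(3)) (use that r1 k in simp)
      qed (rule continuous_on_sphere_powr[OF g(1) p r0(3)] less_imp_le[OF r0(2)])+
      have "(r0 / ?R) ^ (2 * N) \<le> (r0 / r1) ^ (2 * N)"
        using r0 r1 k by (intro power_mono divide_left_mono) auto
      then have N': "(r0 / ?R) ^ (2 * N) \<le> 1 / 2" using N by simp
      have u: "0 \<le> ?u z" "?u z \<le> 1" if "z \<in> sphere 0 ?R" for z
      proof -
        have "z \<in> ball 0 1" using sph that by blast
        from powr_mono2[OF less_imp_le[OF p] norm_ge_zero I1[OF this]]
        have "cmod (I z) powr p \<le> 1 powr p" .
        then show "0 \<le> ?u z" "?u z \<le> 1" by simp_all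
      qed
      have "?Mg ?R - ?Mf ?R = circle_mean (\<lambda>z. cmod (g z) powr p - cmod (f z) powr p) ?R"
        unfolding mean_pow_eq_circle_mean
        by (rule circle_mean_diff[symmetric, OF continuous_on_sphere_powr[OF g(1) p R(3)]
              continuous_on_sphere_powr[OF f(1) p R(3)] less_imp_le[OF R(2)]])
      also have "\<dots> = circle_mean (\<lambda>z. (cmod (H z))\<^sup>2 * ?u z) ?R"
      proof (rule circle_mean_cong)
        fix z :: complex assume z: "z \<in> sphere 0 ?R"
        then have "z \<in> ball 0 1" using sph by blast
        then have "cmod (f z) powr p = cmod (I z) powr p * cmod (g z) powr p"
          by (simp only: fg norm_mult) (simp add: powr_mult)
        then show "cmod (g z) powr p - cmod (f z) powr p = (cmod (H z))\<^sup>2 * ?u z"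
          unfolding H(4)[OF z] by (simp add: algebra_simps)
      qed (use R(2)[of k] in auto)
      also have "\<dots> \<le> 2 * (real N)\<^sup>2 * ?m ?R * circle_mean ?u ?R + 4 * (?m ?R - ?m r0)"
        by (rule circle_mean_weighted_bound[OF H(2) r0(2) _ H(1) N'])
           (use r1 k u cI in \<open>auto intro: continuous_intros\<close>)
      also have "circle_mean ?u ?R = d k"
        using R(2)[of k] by (subst circle_mean_diff) (auto simp: circle_mean_const d_def cI)
      also have "2 * (real N)\<^sup>2 * ?m ?R * d k + 4 * (?m ?R - ?m r0) \<le> 2 * (real N)\<^sup>2 * L * d k + e"
      proof (rule add_mono)
        have "0 \<le> circle_mean ?u ?R"
          by (rule circle_mean_nonneg) (use u cI R(2)[of k] in \<open>auto intro: continuous_intros\<close>)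
        then have "0 \<le> d k" by (simp add: \<open>circle_mean ?u ?R = d k\<close>)
        then show "2 * (real N)\<^sup>2 * ?m ?R * d k \<le> 2 * (real N)\<^sup>2 * L * d k"
          using gL[of ?R] R(2,3)[of k] by (intro mult_right_mono mult_left_mono) (auto simp: mR)
        show "4 * (?m ?R - ?m r0) \<le> e" using gL[of ?R] R(2,3)[of k] mR mr r0 by simp
      qed
      finally show ?thesis .
    qed
    have "L - L' \<le> 2 * (real N)\<^sup>2 * L * 0 + e"
    proof (rule tendsto_le[OF trivial_limit_sequentially])
      show "(\<lambda>k. 2 * (real N)\<^sup>2 * L * d k + e) \<longlonglongrightarrow> 2 * (real N)\<^sup>2 * L * 0 + e"
        by (intro tendsto_intros d)
      show "(\<lambda>k. ?Mg (R k) - ?Mf (R k)) \<longlonglongrightarrow> L - L'" by (intro tendsto_intros Mg Mf)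
      show "eventually (\<lambda>k. ?Mg (R k) - ?Mf (R k) \<le> 2 * (real N)\<^sup>2 * L * d k + e) sequentially"
        using order_tendstoD(1)[OF R1 r1(2)] by (rule eventually_mono) (rule est)
    qed
    then show "L \<le> L' + e" by simp
  qed
  ultimately show ?thesis using L' by simp
qed

text \<open>
  The identity is clear off the zeros of \<open>I\<close> and extends to them by the identity theorem.
\<close>

lemma analytic_quotient_mult:
  assumes f: "f holomorphic_on ball 0 1" and I: "I holomorphic_on ball 0 1" "\<not> I constant_on ball 0 1"
    and g: "analytic_quotient f I holomorphic_on ball 0 1" and z: "z \<in> ball 0 1"
  shows "f z = I z * analytic_quotient f I z"
proof -
  let ?g = "analytic_quotient f I"
  have eq: "f w = I w * ?g w" if w: "w \<in> ball 0 1" "I w \<noteq> 0" for w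
  proof -
    have "f analytic_on {w}" "I analytic_on {w}"
      by (rule holomorphic_on_imp_analytic_at[OF f open_ball w(1)],
          rule holomorphic_on_imp_analytic_at[OF I(1) open_ball w(1)])
    then have "(\<lambda>z. f z / I z) analytic_on {w}" using w(2) by (intro analytic_on_divide) auto
    then have "?g w = f w / I w" unfolding analytic_quotient_def by (rule remove_sings_at_analytic)
    then show ?thesis using w(2) by simp
  qed
  let ?U = "ball 0 1 \<inter> I -` (- {0})"
  have "open ?U"
    by (rule continuous_open_preimage[OF holomorphic_on_imp_continuous_on[OF I(1)] open_ball]) auto
  moreover have "?U \<noteq> {}"
    using I(2) unfolding constant_on_def by blast
  moreover have "(\<lambda>z. I z * ?g z) holomorphic_on ball 0 1"
    using I(1) g by (rule holomorphic_on_mult)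
  ultimately show ?thesis
    by (rule analytic_continuation_open[OF _ open_ball _ connected_ball Int_lower1 f _ _ z])
       (use eq in blast)
qed

section \<open>Strict decrease of the norm\<close>

theorem theorem1p8:
  fixes \<alpha> p :: real and f I :: "complex \<Rightarrow> complex"
  assumes "0 < \<alpha>" and "\<alpha> < 1" and "0 < p"
    and "f \<in> A_space \<alpha> p"
    and "\<exists>z\<in>ball 0 1. f z \<noteq> 0"
    and "inner_function I" and "\<not> I constant_on ball 0 1"
    and "inner_divides p I f"
  shows "A_norm \<alpha> p (analytic_quotient f I) < A_norm \<alpha> p f"
proof -
  define g where "g = analytic_quotient f I"
  note p = assms(3)
  have f: "f holomorphic_on ball 0 1" "A_norm \<alpha> p f < \<infinity>" using assms(4) by (auto simp: A_space_def)
  have holI: "I holomorphic_on ball 0 1" using assms(6) by (simp add: inner_function_def)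
  have gh: "g \<in> hardy_space p" using assms(8) by (simp add: inner_divides_def g_def)
  then have g: "g holomorphic_on ball 0 1" by (simp add: hardy_space_def A_space_def)
  have fg: "f z = I z * g z" if "z \<in> ball 0 1" for z
    using analytic_quotient_mult[OF f(1) holI assms(7)] g that by (simp add: g_def)
  obtain z0 where z0: "z0 \<in> ball 0 1" "f z0 \<noteq> 0" using assms(5) by blast
  then have g0: "\<exists>z\<in>ball 0 1. g z \<noteq> 0" using fg[OF z0(1)] by (intro bexI[of _ z0]) auto
  obtain C where "\<forall>r\<in>{0..<1}. mean_pow p g r \<le> C"
    using hardy_space_mean_pow_bounded[OF gh g0 p] by blast
  then have C: "mean_pow p g r \<le> C" if "0 \<le> r" "r < 1" for r using that by simp
  obtain L where L: "(mean_pow p g \<longlongrightarrow> L) (at_left 1)"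
    by (rule mono_bounded_tendsto_at_left[OF mean_pow_mono[OF g g0 p] C])
  have Lf: "(mean_pow p f \<longlongrightarrow> L) (at_left 1)"
    by (rule mean_pow_inner_multiple_tendsto[OF assms(6) g g0 f(1) assms(5) fg p L])
  let ?w = "weighted_defect \<alpha> p"
  have Nf: "A_norm_pow \<alpha> p f = ennreal L + (\<integral>\<^sup>+ s. ennreal (?w f L s) \<partial>lborel)"
    by (rule A_norm_pow_eq_mean_defect[OF f(1) assms(5) p assms(2) Lf])
  have Ng: "A_norm_pow \<alpha> p g = ennreal L + (\<integral>\<^sup>+ s. ennreal (?w g L s) \<partial>lborel)"
    by (rule A_norm_pow_eq_mean_defect[OF g g0 p assms(2) L])
  \<comment> \<open>Strict inequality survives only because the norm of \<open>f\<close> is finite.\<close>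
  have fin: "A_norm_pow \<alpha> p f \<noteq> \<infinity>" using f(2) by (auto simp: A_norm_def)
  have le: "?w g L s \<le> ?w f L s" for s
  proof (cases "s \<in> {0<..<1}")
    case True
    have "mean_pow p f s \<le> mean_pow p g s"
      by (rule mean_pow_mono_norm[OF f(1) g p])
         (use True inner_function_norm_le_1[OF assms(6)] in \<open>auto simp: fg norm_mult intro!: mult_left_le_one_le\<close>)
    then show ?thesis using True assms(2)
      by (auto simp: weighted_defect_def intro!: mult_left_mono)
  qed (simp add: weighted_defect_def)
  have less: "?w g L s < ?w f L s" if s: "s \<in> {0<..<1} - zero_radii g" for s
  proof -
    have "mean_pow p f s < mean_pow p g s"
    proof (rule mean_pow_less[OF f(1) g p])
      fix z :: complex assume z: "z \<in> sphere 0 s"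
      have "z \<in> ball 0 1" "g z \<noteq> 0" using z s nonzero_on_sphere[of s g z] by auto
      then show "cmod (f z) < cmod (g z)"
        using inner_function_norm_less_1[OF assms(6,7), of z] by (simp add: fg norm_mult)
    qed (use s in auto)
    moreover have "0 < 1 - s\<^sup>2" using s by (simp add: power_less_one_iff)
    ultimately show ?thesis using s assms(2)
      by (auto simp: weighted_defect_def intro!: mult_strict_left_mono)
  qed
  have nonneg: "0 \<le> ?w g L s" for s
    using mono_le_limit_at_left[OF mean_pow_mono[OF g g0 p] L, of s] assms(2)
    by (auto simp: weighted_defect_def indicator_def)
  have "(\<integral>\<^sup>+ s. ennreal (?w g L s) \<partial>lborel) < (\<integral>\<^sup>+ s. ennreal (?w f L s) \<partial>lborel)"
  proof (rule nn_integral_less)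
    show "(\<lambda>s. ennreal (?w g L s)) \<in> borel_measurable lborel" "(\<lambda>s. ennreal (?w f L s)) \<in> borel_measurable lborel"
      using weighted_defect_measurable[OF g p] weighted_defect_measurable[OF f(1) p] by auto
    have "(\<integral>\<^sup>+ s. ennreal (?w g L s) \<partial>lborel) \<le> (\<integral>\<^sup>+ s. ennreal (?w f L s) \<partial>lborel)"
      by (intro nn_integral_mono ennreal_leI le)
    also have "\<dots> < \<infinity>" using fin Nf by (auto simp: less_top)
    finally show "(\<integral>\<^sup>+ s. ennreal (?w g L s) \<partial>lborel) \<noteq> \<infinity>" by simp
    show "AE s in lborel. ennreal (?w g L s) \<le> ennreal (?w f L s)" using le by (simp add: ennreal_leI)
    show "\<not> (AE s in lborel. ennreal (?w f L s) \<le> ennreal (?w g L s))"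
    proof
      assume "AE s in lborel. ennreal (?w f L s) \<le> ennreal (?w g L s)"
      moreover have "AE s in lborel. s \<notin> zero_radii g"
        using countable_imp_null_set_lborel[OF countable_zero_radii[OF g g0]] by (rule AE_not_in)
      ultimately have "AE s in lborel. s \<notin> {0<..<(1::real)}"
      proof eventually_elim
        case (elim s)
        then show ?case using less[of s] nonneg[of s] by (auto simp: ennreal_le_iff2)
      qed
      then have "emeasure lborel {0<..<(1::real)} = 0"
        by (subst (asm) AE_iff_measurable[of "{0<..<1}"]) auto
      then show False by simp
    qed
  qed
  then have lt: "A_norm_pow \<alpha> p g < A_norm_pow \<alpha> p f"
    unfolding Nf Ng by (simp add: ennreal_add_left_cancel_less)
  then have "A_norm_pow \<alpha> p g \<noteq> \<infinity>" by auto
  moreover have less': "enn2real (A_norm_pow \<alpha> p g) < enn2real (A_norm_pow \<alpha> p f)"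
    using lt fin by (simp add: enn2real_less_iff less_top)
  have "enn2real (A_norm_pow \<alpha> p g) powr (1 / p) < enn2real (A_norm_pow \<alpha> p f) powr (1 / p)"
    by (rule powr_less_mono2[OF _ enn2real_nonneg less']) (use p in simp)
  moreover have "0 < enn2real (A_norm_pow \<alpha> p f) powr (1 / p)"
    using order.strict_trans1[OF enn2real_nonneg less'] by simp
  ultimately show ?thesis
    using fin unfolding A_norm_def g_def[symmetric] by (simp add: ennreal_lessI)
qed

end
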